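(* Let $\mathbb{P}$ be a probability measure on a measurable space $(\Omega,\mathcal{F})$, let $\mathcal{H}=\mathcal{L}^1(\Omega,\mathcal{F},\mathbb{P})$ with the $L^1(\mathbb{P})$-norm topology $\tau$, and let the pre-order on $\mathcal{H}$ be the almost sure order: $X\le Y$ if and only if $\mathbb{P}(X\le Y)=1$. Let $\mathcal{R}=\{R\in\mathcal{H}: R\ge0\ \mathbb{P}\text{-a.s.},\ \mathbb{P}(R>0)>0\}$, and let $\mathcal{I}\subset\mathcal{H}$ be the linear subspace of net trades of a frictionless one-period or multi-period discrete-time financial market (see context). Then the financial market $(\mathcal{H},\tau,\le,\mathcal{I},\mathcal{R})$ is viable if and only if there is a martingale measure $\mathbb{Q}$ that has a bounded density with respect to $\mathbb{P}$.
   Context: Net trades: there are a filtration $(\mathcal{F}_t)_{t=0}^T$ on $(\Omega,\mathcal{F})$ ($T\ge1$), an adapted $\mathbb{R}^J_+$-valued process $S=(S_t)_{t=0}^T$ (discounted prices, with a riskless bond with interest rate zero), and $\mathcal{I}$ is the set of $\ell\in\mathcal{H}$ of the form $\ell=\sum_{t=1}^T H_t\cdot(S_t-S_{t-1})$ with $H_t$ an $\mathcal{F}_{t-1}$-measurable $\mathbb{R}^J$-valued function; $\mathcal{I}$ is a linear subspace of $\mathcal{H}$. Agents: $\mathcal{A}$ is the set of complete and transitive binary relations $\preceq$ on $\mathcal{H}$ (with strict part $\prec$) that are (i) weakly monotone: $X\le Y$ implies $X\preceq Y$; (ii) convex: $\{Z\in\mathcal{H}: X\preceq Z\}$ is convex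 for every $X$; (iii) $\tau$-lower semi-continuous: if $X_n\to X$ in $\tau$ and $X_n\preceq Y$ for all $n$, then $X\preceq Y$. Viability: the market is viable if there is a family $\{\preceq_a\}_{a\in A}\subset\mathcal{A}$ such that $\ell\preceq_a 0$ for every $a\in A$ and $\ell\in\mathcal{I}$, and for every $R\in\mathcal{R}$ there is $a\in A$ with $0\prec_a R$. Martingale measure: a probability measure $\mathbb{Q}$ on $(\Omega,\mathcal{F})$ such that $X\mapsto\mathbb{E}_{\mathbb{Q}}[X]$ is a well-defined $\tau$-continuous linear functional on $\mathcal{H}$, positive with respect to $\le$, with $\mathbb{E}_{\mathbb{Q}}[\ell]\le 0$ for all $\ell\in\mathcal{I}$ (equivalently $\mathbb{E}_{\mathbb{Q}}[\ell]=0$ for all $\ell\in\mathcal{I}$, since $\mathcal{I}$ is a linear subspace).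
   Formalization: "Positive with respect to ≤" for a martingale measure is read strictly: also E_Q[X]>0 whenever X≥0 a.s. and P(X>0)>0, so Q is equivalent to P. With weak positivity the "if" direction is false (two states, Q a point mass on one of them). *)

theory Defs
  imports "HOL-Probability.Probability"
begin

text \<open>
  Payoffs are integrable functions, not equivalence classes; functions that agree almost
  surely are identified only through the preorder and the seminorm below.
\<close>

definition payoffs :: "'a measure \<Rightarrow> ('a \<Rightarrow> real) set" where
  "payoffs M = {X. integrable M X}"

definition as_le :: "'a measure \<Rightarrow> ('a \<Rightarrow> real) \<Rightarrow> ('a \<Rightarrow> real) \<Rightarrow> bool" where
  "as_le M X Y \<longleftrightarrow> (AE \<omega> in M. X \<omega> \<le> Y \<omega>)"

definition L1_dist :: "'a measure \<Rightarrow> ('a \<Rightarrow> real) \<Rightarrow> ('a \<Rightarrow> real) \<Rightarrow> real" where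
  "L1_dist M X Y = (\<integral>\<omega>. \<bar>X \<omega> - Y \<omega>\<bar> \<partial>M)"

definition L1_tendsto :: "'a measure \<Rightarrow> (nat \<Rightarrow> 'a \<Rightarrow> real) \<Rightarrow> ('a \<Rightarrow> real) \<Rightarrow> bool" where
  "L1_tendsto M X Y \<longleftrightarrow> (\<lambda>n. L1_dist M (X n) Y) \<longlonglongrightarrow> 0"

definition L1_continuous :: "'a measure \<Rightarrow> (('a \<Rightarrow> real) \<Rightarrow> real) \<Rightarrow> bool" where
  "L1_continuous M \<phi> \<longleftrightarrow>
    (\<forall>X\<in>payoffs M. \<forall>\<epsilon>>0. \<exists>\<delta>>0. \<forall>Y\<in>payoffs M.
       L1_dist M X Y < \<delta> \<longrightarrow> \<bar>\<phi> X - \<phi> Y\<bar> < \<epsilon>)"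

definition relevant :: "'a measure \<Rightarrow> ('a \<Rightarrow> real) set" where
  "relevant M = {R \<in> payoffs M. as_le M (\<lambda>_. 0) R \<and> measure M {\<omega> \<in> space M. R \<omega> > 0} > 0}"

text \<open>
  The \<open>J\<close> risky assets are indexed by the finite type \<open>'J\<close>. Only the times
  \<open>0, \<dots>, T\<close> matter. Prices are discounted, so the bond does not enter the gains.
\<close>

definition price_model ::
  "'a measure \<Rightarrow> nat \<Rightarrow> (nat \<Rightarrow> 'a measure) \<Rightarrow> (nat \<Rightarrow> 'a \<Rightarrow> real ^ 'J) \<Rightarrow> bool" where
  "price_model M T F S \<longleftrightarrow>
     T \<ge> 1 \<and>
     (\<forall>t\<le>T. subalgebra M (F t)) \<and>
     (\<forall>t\<le>T. \<forall>s\<le>t. sets (F s) \<subseteq> sets (F t)) \<and>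
     (\<forall>t\<le>T. S t \<in> borel_measurable (F t)) \<and>
     (\<forall>t\<le>T. \<forall>\<omega>\<in>space M. \<forall>j. 0 \<le> S t \<omega> $ j)"

definition net_trades ::
  "'a measure \<Rightarrow> nat \<Rightarrow> (nat \<Rightarrow> 'a measure) \<Rightarrow> (nat \<Rightarrow> 'a \<Rightarrow> real ^ 'J) \<Rightarrow> ('a \<Rightarrow> real) set" where
  "net_trades M T F S =
     {X \<in> payoffs M. \<exists>H :: nat \<Rightarrow> 'a \<Rightarrow> real ^ 'J.
        (\<forall>t\<in>{1..T}. H t \<in> borel_measurable (F (t - 1))) \<and>
        (\<forall>\<omega>\<in>space M. X \<omega> = (\<Sum>t = 1..T. H t \<omega> \<bullet> (S t \<omega> - S (t - 1) \<omega>)))}"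

text \<open>A preference relation is only constrained, and only ever used, on payoffs.\<close>

definition agents :: "'a measure \<Rightarrow> (('a \<Rightarrow> real) \<Rightarrow> ('a \<Rightarrow> real) \<Rightarrow> bool) set" where
  "agents M = {pref.
     (\<forall>X\<in>payoffs M. \<forall>Y\<in>payoffs M. pref X Y \<or> pref Y X) \<and>
     (\<forall>X\<in>payoffs M. \<forall>Y\<in>payoffs M. \<forall>Z\<in>payoffs M. pref X Y \<longrightarrow> pref Y Z \<longrightarrow> pref X Z) \<and>
     (\<forall>X\<in>payoffs M. \<forall>Y\<in>payoffs M. as_le M X Y \<longrightarrow> pref X Y) \<and>
     (\<forall>X\<in>payoffs M. \<forall>Y\<in>payoffs M. \<forall>Z\<in>payoffs M. \<forall>u\<in>{0..1}.
        pref X Y \<longrightarrow> pref X Z \<longrightarrow> pref X (\<lambda>\<omega>. u * Y \<omega> + (1 - u) * Z \<omega>)) \<and>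
     (\<forall>Xs X Y. range Xs \<subseteq> payoffs M \<longrightarrow> X \<in> payoffs M \<longrightarrow> Y \<in> payoffs M \<longrightarrow>
        L1_tendsto M Xs X \<longrightarrow> (\<forall>n. pref (Xs n) Y) \<longrightarrow> pref X Y)}"

definition strictly_prefers ::
  "(('a \<Rightarrow> real) \<Rightarrow> ('a \<Rightarrow> real) \<Rightarrow> bool) \<Rightarrow> ('a \<Rightarrow> real) \<Rightarrow> ('a \<Rightarrow> real) \<Rightarrow> bool" where
  "strictly_prefers pref X Y \<longleftrightarrow> pref X Y \<and> \<not> pref Y X"

text \<open>A family of agents is represented by the set of its preference relations.\<close>

definition viable :: "'a measure \<Rightarrow> ('a \<Rightarrow> real) set \<Rightarrow> bool" where
  "viable M I \<longleftrightarrow>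
     (\<exists>A \<subseteq> agents M.
        (\<forall>pref\<in>A. \<forall>X\<in>I. pref X (\<lambda>_. 0)) \<and>
        (\<forall>R\<in>relevant M. \<exists>pref\<in>A. strictly_prefers pref (\<lambda>_. 0) R))"

text \<open>
  Positivity of a functional is understood strictly with respect to the preorder: besides
  being monotone, it assigns a positive value to every positive payoff, that is, to every
  \<open>X\<close> with \<open>0 \<le> X\<close> but not \<open>X \<le> 0\<close>. For expectations under a measure with a density this
  says that the measure is equivalent to \<open>M\<close>. Monotonicity alone would not suffice: a
  martingale measure that vanishes on part of \<open>M\<close> does not exclude arbitrage there.
\<close>

definition positive_functional :: "'a measure \<Rightarrow> (('a \<Rightarrow> real) \<Rightarrow> real) \<Rightarrow> bool" where
  "positive_functional M \<phi> \<longleftrightarrow>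
     (\<forall>X\<in>payoffs M. as_le M (\<lambda>_. 0) X \<longrightarrow> 0 \<le> \<phi> X) \<and>
     (\<forall>X\<in>payoffs M. as_le M (\<lambda>_. 0) X \<and> \<not> as_le M X (\<lambda>_. 0) \<longrightarrow> 0 < \<phi> X)"

text \<open>
  Integrability under \<open>Q\<close> is what makes the expectation functional well defined on payoffs
  (the Bochner integral of a non-integrable function is 0); linearity then is automatic.
\<close>

definition martingale_measure :: "'a measure \<Rightarrow> ('a \<Rightarrow> real) set \<Rightarrow> 'a measure \<Rightarrow> bool" where
  "martingale_measure M I Q \<longleftrightarrow>
     prob_space Q \<and> sets Q = sets M \<and>
     (\<forall>X\<in>payoffs M. integrable Q X) \<and>
     L1_continuous M (\<lambda>X. \<integral>\<omega>. X \<omega> \<partial>Q) \<and>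
     positive_functional M (\<lambda>X. \<integral>\<omega>. X \<omega> \<partial>Q) \<and>
     (\<forall>X\<in>I. (\<integral>\<omega>. X \<omega> \<partial>Q) \<le> 0)"

definition has_bounded_density :: "'a measure \<Rightarrow> 'a measure \<Rightarrow> bool" where
  "has_bounded_density M Q \<longleftrightarrow>
     (\<exists>Z \<in> borel_measurable M. \<exists>c::real.
        (\<forall>\<omega>\<in>space M. 0 \<le> Z \<omega> \<and> Z \<omega> \<le> c) \<and> Q = density M (\<lambda>\<omega>. ennreal (Z \<omega>)))"

end

theory Submission
  imports Defs "HOL-Library.Function_Algebras"
begin

text \<open>
  If some agent strictly prefers \<open>R\<close> to \<open>0\<close>, lower semicontinuity provides a ball around \<open>R\<close> in
  which nothing is weakly worse than \<open>0\<close>. By monotonicity everything in the cone \<open>D\<close> of net trades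
  minus nonnegative payoffs is weakly worse than \<open>0\<close>, so \<open>R\<close> has positive \<open>L\<^sup>1\<close>-distance from \<open>D\<close>.
  The distance from \<open>D\<close> is sublinear. Hahn-Banach yields a linear functional below it that
  agrees with it at \<open>R\<close>. This functional is bounded in \<open>L\<^sup>1\<close>, nonnegative on nonnegative payoffs
  and nonpositive on net trades, hence given by a bounded density \<open>Z\<close> with \<open>E[Z R] > 0\<close>. Taking \<open>R\<close>
  to be indicators, countable mixtures of such densities are exhausted to one that is positive
  almost surely (as in the Halmos-Savage and Kreps-Yan theorems). Conversely, expectation under a
  martingale measure defines a single agent that supports the market.
\<close>

section \<open>Dominated linear functionals\<close>

instantiation "fun" :: (type, real_vector) real_vector
begin

definition scaleR_fun :: "real \<Rightarrow> ('a \<Rightarrow> 'b) \<Rightarrow> 'a \<Rightarrow> 'b" where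
  "scaleR_fun c f = (\<lambda>x. c *\<^sub>R f x)"

instance
  by standard (auto simp: scaleR_fun_def fun_eq_iff algebra_simps)

end

lemma scaleR_fun_apply [simp]: "(c *\<^sub>R f) x = c *\<^sub>R f x"
  by (simp add: scaleR_fun_def)

section \<open>Sublinear functionals on a subspace\<close>

definition sublinear_on :: "'v::real_vector set \<Rightarrow> ('v \<Rightarrow> real) \<Rightarrow> bool" where
  "sublinear_on V q \<longleftrightarrow>
    (\<forall>x\<in>V. \<forall>y\<in>V. q (x + y) \<le> q x + q y) \<and>
    (\<forall>x\<in>V. \<forall>c>0. q (c *\<^sub>R x) \<le> c * q x)"

lemma sublinear_onI:
  assumes "\<And>x y. x \<in> V \<Longrightarrow> y \<in> V \<Longrightarrow> q (x + y) \<le> q x + q y"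
    and "\<And>x c. x \<in> V \<Longrightarrow> c > 0 \<Longrightarrow> q (c *\<^sub>R x) \<le> c * q x"
  shows "sublinear_on V q"
  using assms by (auto simp: sublinear_on_def)

lemma sublinear_on_add: "sublinear_on V q \<Longrightarrow> x \<in> V \<Longrightarrow> y \<in> V \<Longrightarrow> q (x + y) \<le> q x + q y"
  by (auto simp: sublinear_on_def)

text \<open>Homogeneity is postulated only as an inequality; applying it with
  \<open>inverse c\<close> to \<open>c *\<^sub>R x\<close> gives the reverse one.\<close>

lemma sublinear_on_scaleR:
  assumes q: "sublinear_on V q" and V: "subspace V" and x: "x \<in> V" and c: "c > 0"
  shows "q (c *\<^sub>R x) = c * q x"
proof (rule antisym)
  show "q (c *\<^sub>R x) \<le> c * q x"
    using q x c by (auto simp: sublinear_on_def)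
  have "q (inverse c *\<^sub>R (c *\<^sub>R x)) \<le> inverse c * q (c *\<^sub>R x)"
    using q x c V unfolding sublinear_on_def
    by (meson positive_imp_inverse_positive subspace_scale)
  then show "c * q x \<le> q (c *\<^sub>R x)"
    using c by (simp add: field_simps)
qed

lemma sublinear_on_0:
  assumes "sublinear_on V q" "subspace V"
  shows "q 0 = 0"
  using sublinear_on_scaleR[OF assms subspace_0[OF assms(2)], of 2] by simp

lemma sublinear_on_minus:
  assumes "sublinear_on V q" "subspace V" "x \<in> V"
  shows "- q (- x) \<le> q x"
  using sublinear_on_add[OF assms(1,3) subspace_neg[OF assms(2,3)]] sublinear_on_0[OF assms(1,2)]
  by simp

text \<open>
  Tilting a sublinear functional makes it linear along the line spanned by \<open>y\<close>. A minimal
  sublinear functional equals all its tilts.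
\<close>

definition tilt :: "('v::real_vector \<Rightarrow> real) \<Rightarrow> 'v \<Rightarrow> 'v \<Rightarrow> real" where
  "tilt q y x = (INF t\<in>{0..}. q (x + t *\<^sub>R y) - t * q y)"

context
  fixes V :: "'v::real_vector set" and q :: "'v \<Rightarrow> real" and y :: 'v
  assumes V: "subspace V" and q: "sublinear_on V q" and y: "y \<in> V"
begin

text \<open>Splitting \<open>t *\<^sub>R y\<close> as \<open>(x + t *\<^sub>R y) + (- x)\<close>,
  subadditivity yields the lower bound \<open>- q (- x)\<close>, uniform in \<open>t\<close>. The
  real infimum in \<open>tilt\<close> is meaningful only with such a bound.\<close>

lemma tilt_bdd_below:
  assumes x: "x \<in> V"
  shows "bdd_below ((\<lambda>t. q (x + t *\<^sub>R y) - t * q y) ` {0..})"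
proof (rule bdd_belowI2)
  fix t :: real assume t: "t \<in> {0..}"
  have "t * q y = q (t *\<^sub>R y)"
    using t sublinear_on_scaleR[OF q V y, of t] sublinear_on_0[OF q V] by (cases "t = 0") auto
  also have "\<dots> = q ((x + t *\<^sub>R y) + (- x))" by simp
  also have "\<dots> \<le> q (x + t *\<^sub>R y) + q (- x)"
    using x y V by (intro sublinear_on_add[OF q]) (auto simp: subspace_add subspace_scale subspace_neg)
  finally show "- q (- x) \<le> q (x + t *\<^sub>R y) - t * q y" by simp
qed

lemma tilt_le_at:
  assumes "x \<in> V" "t \<ge> 0"
  shows "tilt q y x \<le> q (x + t *\<^sub>R y) - t * q y"
  unfolding tilt_def using assms by (intro cINF_lower tilt_bdd_below) auto

lemma tilt_le: "x \<in> V \<Longrightarrow> tilt q y x \<le> q x"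
  using tilt_le_at[of x 0] by simp

lemma tilt_geI:
  assumes "\<And>t. t \<ge> 0 \<Longrightarrow> a \<le> q (x + t *\<^sub>R y) - t * q y"
  shows "a \<le> tilt q y x"
  unfolding tilt_def using assms by (intro cINF_greatest) auto

text \<open>Parameters combine: \<open>s\<close> for \<open>x\<close> and \<open>t\<close> for
  \<open>z\<close> give \<open>s + t\<close> for \<open>x + z\<close>, and rescaling
  \<open>x\<close> by \<open>c\<close> turns \<open>t\<close> into \<open>c * t\<close>.\<close>

lemma sublinear_on_tilt: "sublinear_on V (tilt q y)"
proof (rule sublinear_onI)
  fix x z assume x: "x \<in> V" and z: "z \<in> V"
  have *: "tilt q y (x + z) \<le> (q (x + s *\<^sub>R y) - s * q y) + (q (z + t *\<^sub>R y) - t * q y)"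
    if "s \<ge> 0" "t \<ge> 0" for s t
  proof -
    have "tilt q y (x + z) \<le> q ((x + s *\<^sub>R y) + (z + t *\<^sub>R y)) - (s + t) * q y"
      using tilt_le_at[OF subspace_add[OF V x z], of "s + t"] that by (simp add: algebra_simps)
    moreover have "q ((x + s *\<^sub>R y) + (z + t *\<^sub>R y)) \<le> q (x + s *\<^sub>R y) + q (z + t *\<^sub>R y)"
      using x y z V by (intro sublinear_on_add[OF q]) (auto simp: subspace_add subspace_scale)
    ultimately show ?thesis by (simp add: algebra_simps)
  qed
  \<comment> \<open>The infimum is taken over \<open>t\<close> with \<open>s\<close> fixed, and then
    over \<open>s\<close>.\<close>
  have "tilt q y (x + z) - (q (x + s *\<^sub>R y) - s * q y) \<le> tilt q y z" if "s \<ge> 0" for s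
    using *[OF that] by (intro tilt_geI) (simp add: algebra_simps)
  then have "tilt q y (x + z) - tilt q y z \<le> tilt q y x"
    by (intro tilt_geI) (simp add: algebra_simps)
  then show "tilt q y (x + z) \<le> tilt q y x + tilt q y z" by simp
next
  fix x and c :: real assume x: "x \<in> V" and c: "c > 0"
  have "tilt q y (c *\<^sub>R x) / c \<le> tilt q y x"
  proof (rule tilt_geI)
    fix t :: real assume t: "t \<ge> 0"
    have "tilt q y (c *\<^sub>R x) \<le> q (c *\<^sub>R x + (c * t) *\<^sub>R y) - (c * t) * q y"
      using tilt_le_at[OF subspace_scale[OF V x]] c t by simp
    also have "q (c *\<^sub>R x + (c * t) *\<^sub>R y) = c * q (x + t *\<^sub>R y)"
      using sublinear_on_scaleR[OF q V _ c, of "x + t *\<^sub>R y"] x y V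
      by (simp add: subspace_add subspace_scale algebra_simps)
    finally show "tilt q y (c *\<^sub>R x) / c \<le> q (x + t *\<^sub>R y) - t * q y"
      using c by (simp add: field_simps)
  qed
  then show "tilt q y (c *\<^sub>R x) \<le> c * tilt q y x"
    using c by (simp add: field_simps)
qed

text \<open>The member \<open>t = 1\<close> of the infimum is \<open>q 0 - q y\<close>. This pins
  the value at \<open>y\<close>: a linear functional below the tilt is at least \<open>q y\<close>
  there.\<close>

lemma tilt_minus: "tilt q y (- y) \<le> - q y"
  using tilt_le_at[OF subspace_neg[OF V y], of 1] sublinear_on_0[OF q V] by simp

end

text \<open>Zorn's lemma for the reversed pointwise order, where a nonempty chain is bounded by its
  pointwise infimum. Subadditivity passes to this infimum because members of a chain are
  comparable.\<close>

lemma minimal_sublinear: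
  assumes V: "subspace V" and p: "sublinear_on V p"
  shows "\<exists>q. sublinear_on V q \<and> (\<forall>x\<in>V. q x \<le> p x) \<and>
    (\<forall>r. sublinear_on V r \<longrightarrow> (\<forall>x\<in>V. r x \<le> q x) \<longrightarrow> (\<forall>x\<in>V. r x = q x))"
proof -
  \<comment> \<open>Functionals are made to vanish off \<open>V\<close> so that the pointwise order is antisymmetric.\<close>
  define A where "A = {q. sublinear_on V q \<and> (\<forall>x\<in>V. q x \<le> p x) \<and> (\<forall>x. x \<notin> V \<longrightarrow> q x = 0)}"
  define restr where "restr = (\<lambda>q x. if x \<in> V then q x else (0::real))"
  have restr_sub: "sublinear_on V (restr q)" if "sublinear_on V q" for q
    using that V unfolding restr_def sublinear_on_def by (auto simp: subspace_add subspace_scale)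
  have "\<exists>m\<in>A. \<forall>a\<in>A. m \<ge> a \<longrightarrow> a = m"
  proof (rule predicate_Zorn)
    show "partial_order_on A (relation_of (\<ge>) A)"
      by (intro partial_order_on_relation_ofI) auto
  next
    fix C assume "C \<in> Chains (relation_of (\<ge>) A)"
    then have CA: "C \<subseteq> A" and chain: "\<And>a b. a \<in> C \<Longrightarrow> b \<in> C \<Longrightarrow> a \<ge> b \<or> b \<ge> a"
      by (auto simp: Chains_def relation_of_def)
    show "\<exists>u\<in>A. \<forall>a\<in>C. a \<ge> u"
    proof (cases "C = {}")
      case True
      \<comment> \<open>The empty chain also needs a bound in \<open>A\<close>; \<open>p\<close>,
        cut off outside \<open>V\<close>, serves.\<close>
      have "restr p \<in> A" using restr_sub[OF p] by (auto simp: A_def restr_def)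
      then show ?thesis using True by blast
    next
      case False
      define u where "u = restr (\<lambda>x. INF q\<in>C. q x)"
      have sub: "sublinear_on V a" if "a \<in> C" for a using that CA by (auto simp: A_def)
      \<comment> \<open>Every member lies below \<open>p\<close>, so \<open>- p (- x)\<close> bounds
        the whole chain from below at \<open>x\<close>.\<close>
      have bdd: "bdd_below ((\<lambda>q. q x) ` C)" if x: "x \<in> V" for x
      proof (rule bdd_belowI2)
        fix a assume a: "a \<in> C"
        have "a (- x) \<le> p (- x)" using a x CA V by (auto simp: A_def subspace_neg)
        then show "- p (- x) \<le> a x" using sublinear_on_minus[OF sub[OF a] V x] by simp
      qed
      have u_le: "u x \<le> a x" if "a \<in> C" "x \<in> V" for a x
        using that bdd by (auto simp: u_def restr_def intro!: cINF_lower)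
      have u_geI: "b \<le> u x" if "\<And>a. a \<in> C \<Longrightarrow> b \<le> a x" "x \<in> V" for b x
        using that False by (auto simp: u_def restr_def intro!: cINF_greatest)
      have "sublinear_on V u"
      proof (rule sublinear_onI)
        fix x y assume x: "x \<in> V" and y: "y \<in> V"
        \<comment> \<open>The smaller of \<open>a\<close> and \<open>b\<close> can stand in for
          both, and its own subadditivity gives the bound.\<close>
        have *: "u (x + y) \<le> a x + b y" if a: "a \<in> C" and b: "b \<in> C" for a b
        proof -
          have xy: "x + y \<in> V" using x y V by (simp add: subspace_add)
          from chain[OF a b] show ?thesis
          proof
            assume "b \<le> a"
            then have "b x \<le> a x" by (simp add: le_funD)
            then show ?thesis
              using u_le[OF b xy] sublinear_on_add[OF sub[OF b] x y] by simp
          next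
            assume "a \<le> b"
            then have "a y \<le> b y" by (simp add: le_funD)
            then show ?thesis
              using u_le[OF a xy] sublinear_on_add[OF sub[OF a] x y] by simp
          qed
        qed
        have "u (x + y) - a x \<le> u y" if "a \<in> C" for a
          using *[OF that] y by (intro u_geI) (auto simp: algebra_simps)
        then have "u (x + y) - u y \<le> u x"
          using x by (intro u_geI) (auto simp: algebra_simps)
        then show "u (x + y) \<le> u x + u y" by simp
      next
        fix x and c :: real assume x: "x \<in> V" and c: "c > 0"
        have "u (c *\<^sub>R x) / c \<le> u x"
        proof (rule u_geI[OF _ x])
          fix a assume a: "a \<in> C"
          have "u (c *\<^sub>R x) \<le> c * a x"
            using u_le[OF a subspace_scale[OF V x]] sublinear_on_scaleR[OF sub[OF a] V x c] by metis
          then show "u (c *\<^sub>R x) / c \<le> a x" using c by (simp add: field_simps)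
        qed
        then show "u (c *\<^sub>R x) \<le> c * u x" using c by (simp add: field_simps)
      qed
      moreover have "u x \<le> p x" if x: "x \<in> V" for x
      proof -
        obtain a where a: "a \<in> C" using False by blast
        then have "a x \<le> p x" using CA x by (auto simp: A_def)
        then show ?thesis using u_le[OF a x] by simp
      qed
      moreover have "u x = 0" if "x \<notin> V" for x using that by (simp add: u_def restr_def)
      ultimately have "u \<in> A" by (auto simp: A_def)
      moreover have "a \<ge> u" if a: "a \<in> C" for a
      proof (rule le_funI)
        fix x show "u x \<le> a x"
          using u_le[OF a] a CA by (cases "x \<in> V") (auto simp: A_def u_def restr_def)
      qed
      ultimately show ?thesis by blast
    qed
  qed
  then obtain m where m: "m \<in> A" and min: "\<And>a. a \<in> A \<Longrightarrow> a \<le> m \<Longrightarrow> a = m" by blast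
  show ?thesis
  proof (intro exI[of _ m] conjI allI impI ballI)
    show "sublinear_on V m" "\<And>x. x \<in> V \<Longrightarrow> m x \<le> p x" using m by (auto simp: A_def)
    fix r x assume r: "sublinear_on V r" and le: "\<forall>x\<in>V. r x \<le> m x" and x: "x \<in> V"
    have "restr r \<in> A"
      using restr_sub[OF r] m le by (force simp: A_def restr_def)
    moreover have "restr r \<le> m"
      using le m by (auto simp: A_def restr_def le_fun_def)
    ultimately have "restr r = m" by (rule min)
    then show "r x = m x" using x by (auto simp: restr_def)
  qed
qed

text \<open>Hahn-Banach with a prescribed contact point. A minimal sublinear functional
  \<open>g\<close> below \<open>tilt p y\<close> equals each of its own tilts and is therefore
  additive; lying below the tilt, and not just below \<open>p\<close>, forces
  \<open>g y = p y\<close>.\<close>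

theorem dominated_linear_functional:
  fixes V :: "'v::real_vector set"
  assumes V: "subspace V" and p: "sublinear_on V p" and y: "y \<in> V"
  shows "\<exists>f. (\<forall>x\<in>V. \<forall>z\<in>V. f (x + z) = f x + f z) \<and>
    (\<forall>c. \<forall>x\<in>V. f (c *\<^sub>R x) = c * f x) \<and> (\<forall>x\<in>V. f x \<le> p x) \<and> f y = p y"
proof -
  obtain g where g: "sublinear_on V g" and le': "\<forall>x\<in>V. g x \<le> tilt p y x"
    and min: "\<forall>r. sublinear_on V r \<longrightarrow> (\<forall>x\<in>V. r x \<le> g x) \<longrightarrow> (\<forall>x\<in>V. r x = g x)"
    using minimal_sublinear[OF V sublinear_on_tilt[OF V p y]] by blast
  have le: "g x \<le> tilt p y x" if "x \<in> V" for x using le' that by blast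
  have add: "g (x + z) = g x + g z" if x: "x \<in> V" and z: "z \<in> V" for x z
  proof (rule antisym)
    show "g (x + z) \<le> g x + g z" by (rule sublinear_on_add[OF g x z])
    \<comment> \<open>The tilt by \<open>z\<close> is sublinear and below \<open>g\<close>, so
      minimality makes it equal to \<open>g\<close>; its member \<open>t = 1\<close> then gives
      superadditivity.\<close>
    have "g x = tilt g z x"
      using min sublinear_on_tilt[OF V g z] tilt_le[OF V g z] x by metis
    also have "\<dots> \<le> g (x + z) - g z" using tilt_le_at[OF V g z x, of 1] by simp
    finally show "g x + g z \<le> g (x + z)" by simp
  qed
  have neg: "g (- x) = - g x" if x: "x \<in> V" for x
    using add[OF x subspace_neg[OF V x]] sublinear_on_0[OF g V] by simp
  have scale: "g (c *\<^sub>R x) = c * g x" if x: "x \<in> V" for c x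
  proof -
    consider "c > 0" | "c = 0" | "c < 0" by linarith
    then show ?thesis
    proof cases
      case 1 then show ?thesis using sublinear_on_scaleR[OF g V x] by simp
    next
      case 2 then show ?thesis using sublinear_on_0[OF g V] by simp
    next
      case 3
      then show ?thesis
        using sublinear_on_scaleR[OF g V x, of "- c"] neg[OF subspace_scale[OF V x, of c]] by simp
    qed
  qed
  have le_p: "g x \<le> p x" if "x \<in> V" for x
    using le[OF that] tilt_le[OF V p y that] by simp
  have "g (- y) \<le> - p y"
    using le[OF subspace_neg[OF V y]] tilt_minus[OF V p y] by simp
  then have "g y = p y" using neg[OF y] le_p[OF y] by simp
  with add scale le_p show ?thesis by blast
qed

text \<open>This distance from a convex cone is the dominating functional for Hahn-Banach. As
  \<open>D\<close> is closed under sums and positive multiples, approximants of \<open>x\<close> and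
  \<open>y\<close> add up to one of \<open>x + y\<close> and scale along with
  \<open>x\<close>.\<close>

lemma sublinear_cone_distance:
  fixes n :: "'v::real_vector \<Rightarrow> real"
  assumes V: "subspace V" and n: "sublinear_on V n" and n_nonneg: "\<And>x. x \<in> V \<Longrightarrow> 0 \<le> n x"
    and DV: "D \<subseteq> V" and D0: "0 \<in> D"
    and D_add: "\<And>d e. d \<in> D \<Longrightarrow> e \<in> D \<Longrightarrow> d + e \<in> D"
    and D_scale: "\<And>c d. c > 0 \<Longrightarrow> d \<in> D \<Longrightarrow> c *\<^sub>R d \<in> D"
  shows "sublinear_on V (\<lambda>x. INF d\<in>D. n (x - d))"
    and "\<And>x d. x \<in> V \<Longrightarrow> d \<in> D \<Longrightarrow> (INF d\<in>D. n (x - d)) \<le> n (x - d)"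
proof -
  define p where "p = (\<lambda>x. INF d\<in>D. n (x - d))"
  have p_le: "p x \<le> n (x - d)" if x: "x \<in> V" and d: "d \<in> D" for x d
    unfolding p_def
  proof (rule cINF_lower[OF _ d])
    show "bdd_below ((\<lambda>d. n (x - d)) ` D)"
      using x DV V by (intro bdd_belowI2[of _ 0] n_nonneg) (auto simp: subspace_diff)
  qed
  have p_geI: "b \<le> p x" if "\<And>d. d \<in> D \<Longrightarrow> b \<le> n (x - d)" for b x
    unfolding p_def using that D0 by (intro cINF_greatest) auto
  show "sublinear_on V (\<lambda>x. INF d\<in>D. n (x - d))"
    unfolding p_def[symmetric]
  proof (rule sublinear_onI)
    fix x y assume x: "x \<in> V" and y: "y \<in> V"
    have *: "p (x + y) \<le> n (x - d) + n (y - e)" if d: "d \<in> D" and e: "e \<in> D" for d e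
    proof -
      have "p (x + y) \<le> n ((x - d) + (y - e))"
        using p_le[OF subspace_add[OF V x y] D_add[OF d e]] by (simp add: algebra_simps)
      also have "\<dots> \<le> n (x - d) + n (y - e)"
        using x y d e DV V by (intro sublinear_on_add[OF n]) (auto simp: subspace_diff)
      finally show ?thesis .
    qed
    have "p (x + y) - n (x - d) \<le> p y" if "d \<in> D" for d
      using *[OF that] by (intro p_geI) (simp add: algebra_simps)
    then have "p (x + y) - p y \<le> p x"
      by (intro p_geI) (simp add: algebra_simps)
    then show "p (x + y) \<le> p x + p y" by simp
  next
    fix x and c :: real assume x: "x \<in> V" and c: "c > 0"
    have "p (c *\<^sub>R x) / c \<le> p x"
    proof (rule p_geI)
      fix d assume d: "d \<in> D"
      have "p (c *\<^sub>R x) \<le> n (c *\<^sub>R (x - d))"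
        using p_le[OF subspace_scale[OF V x] D_scale[OF c d]] by (simp add: algebra_simps)
      also have "\<dots> = c * n (x - d)"
        using x d DV V by (intro sublinear_on_scaleR[OF n V _ c]) (auto simp: subspace_diff)
      finally show "p (c *\<^sub>R x) / c \<le> n (x - d)" using c by (simp add: field_simps)
    qed
    then show "p (c *\<^sub>R x) \<le> c * p x" using c by (simp add: field_simps)
  qed
  show "\<And>x d. x \<in> V \<Longrightarrow> d \<in> D \<Longrightarrow> (INF d\<in>D. n (x - d)) \<le> n (x - d)"
    using p_le by (simp add: p_def)
qed

section \<open>Densities\<close>

text \<open>Domination gives absolute continuity, hence a Radon-Nikodym derivative. The set where it
  exceeds 1 must be null, since otherwise \<open>N\<close> would give it more mass than
  \<open>M\<close> does.\<close>

lemma (in finite_measure) measure_le_density: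
  assumes sets_N: "sets N = sets M"
    and le: "\<And>A. A \<in> sets M \<Longrightarrow> emeasure N A \<le> emeasure M A"
  shows "\<exists>Z\<in>borel_measurable M. (\<forall>\<omega>. 0 \<le> Z \<omega> \<and> Z \<omega> \<le> (1::real)) \<and> N = density M Z"
proof -
  have "absolutely_continuous M N"
    using le by (auto simp: absolutely_continuous_def null_sets_def sets_N) (metis le_zero_eq)
  from Radon_Nikodym[OF this sets_N]
  obtain h where h[measurable]: "h \<in> borel_measurable M" and N: "density M h = N" by blast
  define B where "B = {\<omega>\<in>space M. h \<omega> > 1}"
  have B[measurable]: "B \<in> sets M" unfolding B_def by measurable
  have NB: "(\<integral>\<^sup>+\<omega>. h \<omega> * indicator B \<omega> \<partial>M) \<le> emeasure M B"
    using le[OF B] by (simp add: N[symmetric] emeasure_density)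
  have "(\<integral>\<^sup>+\<omega>. (h \<omega> * indicator B \<omega> - indicator B \<omega>) \<partial>M) =
      (\<integral>\<^sup>+\<omega>. h \<omega> * indicator B \<omega> \<partial>M) - (\<integral>\<^sup>+\<omega>. indicator B \<omega> \<partial>M)"
    by (rule nn_integral_diff) (auto simp: B_def less_imp_le split: split_indicator)
  \<comment> \<open>\<open>NB\<close> bounds the first integral by the second, which is finite, so
    the extended difference is 0.\<close>
  also have "\<dots> = 0"
    using NB le_less_trans[OF NB] by (simp add: diff_eq_0_iff_ennreal emeasure_eq_measure)
  finally have "AE \<omega> in M. h \<omega> * indicator B \<omega> - indicator B \<omega> = 0"
    by (subst (asm) nn_integral_0_iff_AE) auto
  then have h1: "AE \<omega> in M. h \<omega> \<le> 1"
  proof (rule AE_mp[OF _ AE_I2], intro impI)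
    fix \<omega> assume \<omega>: "\<omega> \<in> space M" and z: "h \<omega> * indicator B \<omega> - indicator B \<omega> = 0"
    show "h \<omega> \<le> 1"
    proof (rule ccontr)
      assume "\<not> h \<omega> \<le> 1"
      with \<omega> have "\<omega> \<in> B" "1 < h \<omega>" by (auto simp: B_def)
      with z show False by (auto simp: diff_eq_0_iff_ennreal)
    qed
  qed
  \<comment> \<open>Truncating at 1 alters \<open>h\<close> only on a null set, but gives the bounds
    at every point and makes the passage to real values exact.\<close>
  define Z where "Z \<omega> = enn2real (min 1 (h \<omega>))" for \<omega>
  have [measurable]: "Z \<in> borel_measurable M" unfolding Z_def by measurable
  have "0 \<le> Z \<omega> \<and> Z \<omega> \<le> 1" for \<omega>
    using enn2real_mono[of "min 1 (h \<omega>)" 1] by (auto simp: Z_def)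
  moreover have "N = density M Z"
    unfolding N[symmetric]
  proof (rule density_cong)
    show "AE \<omega> in M. h \<omega> = ennreal (Z \<omega>)"
      using h1
    proof eventually_elim
      fix \<omega> assume "h \<omega> \<le> 1"
      moreover have "(1::ennreal) < top" by simp
      ultimately have "h \<omega> < top" by (rule le_less_trans)
      then show "h \<omega> = ennreal (Z \<omega>)" using \<open>h \<omega> \<le> 1\<close> by (simp add: Z_def min_def)
    qed
  qed auto
  ultimately show ?thesis by (intro bexI[of _ Z]) auto
qed

section \<open>Representing positive, L1-bounded functionals by densities\<close>

locale L1_functional = finite_measure M for M :: "'a measure" +
  fixes f :: "('a \<Rightarrow> real) \<Rightarrow> real"
  assumes add: "integrable M X \<Longrightarrow> integrable M Y \<Longrightarrow> f (\<lambda>\<omega>. X \<omega> + Y \<omega>) = f X + f Y"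
    and scale: "integrable M X \<Longrightarrow> f (\<lambda>\<omega>. c * X \<omega>) = c * f X"
    and le_L1: "integrable M X \<Longrightarrow> f X \<le> (\<integral>\<omega>. \<bar>X \<omega>\<bar> \<partial>M)"
    and nonneg: "integrable M X \<Longrightarrow> (\<And>\<omega>. 0 \<le> X \<omega>) \<Longrightarrow> 0 \<le> f X"
begin

lemma integrable_indicator: "A \<in> sets M \<Longrightarrow> integrable M (indicator A :: 'a \<Rightarrow> real)"
  by (simp add: integrable_real_indicator emeasure_eq_measure)

lemma abs_diff_le_L1:
  assumes X: "integrable M X" and Y: "integrable M Y"
  shows "\<bar>f X - f Y\<bar> \<le> (\<integral>\<omega>. \<bar>X \<omega> - Y \<omega>\<bar> \<partial>M)"
proof -
  have *: "f X - f Y \<le> (\<integral>\<omega>. \<bar>X \<omega> - Y \<omega>\<bar> \<partial>M)" if X: "integrable M X" and Y: "integrable M Y" for X Y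
  proof -
    have "f (\<lambda>\<omega>. X \<omega> + - 1 * Y \<omega>) = f X - f Y"
      using add[of X "\<lambda>\<omega>. - 1 * Y \<omega>"] scale[OF Y, of "- 1"] X Y by simp
    then show ?thesis using le_L1[of "\<lambda>\<omega>. X \<omega> + - 1 * Y \<omega>"] X Y by simp
  qed
  show ?thesis
    using *[OF X Y] *[OF Y X] by (simp add: abs_minus_commute abs_le_iff)
qed

text \<open>\<open>f\<close> is 1-Lipschitz for the L1 distance, and dominated convergence supplies
  L1 convergence, with \<open>w\<close> plus the absolute value of \<open>X\<close> as
  majorant.\<close>

lemma tendsto_dominated:
  assumes s: "\<And>i. integrable M (s i)" and X: "integrable M X" and w: "integrable M w"
    and lim: "\<And>\<omega>. \<omega> \<in> space M \<Longrightarrow> (\<lambda>i. s i \<omega>) \<longlonglongrightarrow> X \<omega>"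
    and bnd: "\<And>i \<omega>. \<omega> \<in> space M \<Longrightarrow> \<bar>s i \<omega>\<bar> \<le> w \<omega>"
  shows "(\<lambda>i. f (s i)) \<longlonglongrightarrow> f X"
proof -
  have "(\<lambda>i. \<integral>\<omega>. \<bar>s i \<omega> - X \<omega>\<bar> \<partial>M) \<longlonglongrightarrow> (\<integral>\<omega>. 0 \<partial>M)"
  proof (rule integral_dominated_convergence[where w="\<lambda>\<omega>. w \<omega> + \<bar>X \<omega>\<bar>"])
    show "AE \<omega> in M. (\<lambda>i. \<bar>s i \<omega> - X \<omega>\<bar>) \<longlonglongrightarrow> 0"
      using tendsto_rabs_zero[OF LIM_zero[OF lim]] by auto
    show "AE \<omega> in M. norm \<bar>s i \<omega> - X \<omega>\<bar> \<le> w \<omega> + \<bar>X \<omega>\<bar>" for i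
      using bnd[of _ i] by (intro AE_I2) (smt (verit) real_norm_def)
  qed (use s X w in auto)
  then have "(\<lambda>i. \<integral>\<omega>. \<bar>s i \<omega> - X \<omega>\<bar> \<partial>M) \<longlonglongrightarrow> 0" by simp
  then have "(\<lambda>i. f (s i) - f X) \<longlonglongrightarrow> 0"
    by (rule Lim_null_comparison[rotated]) (use abs_diff_le_L1[OF s X] in auto)
  then show ?thesis by (rule LIM_zero_cancel)
qed

text \<open>Countable additivity of the set function induced by \<open>f\<close>: finite unions by
  additivity, then a limit under the constant majorant 1.\<close>

lemma sums_disjoint:
  assumes A: "range A \<subseteq> sets M" and disj: "disjoint_family A"
  shows "(\<lambda>i. f (indicator (A i))) sums f (indicator (\<Union>i. A i))"
proof -
  have [measurable]: "A i \<in> sets M" for i using A by auto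
  have "f (indicator (\<Union>i<n. A i)) = (\<Sum>i<n. f (indicator (A i)))" for n
  proof (induction n)
    case 0
    show ?case using scale[of "\<lambda>_. 0" 0] by (simp add: indicator_def)
  next
    case (Suc n)
    have "A n \<inter> A i = {}" if "i < n" for i
      using disj that by (intro disjoint_family_onD) auto
    then have "(indicator (\<Union>i<Suc n. A i) :: 'a \<Rightarrow> real) =
        (\<lambda>\<omega>. indicator (A n) \<omega> + indicator (\<Union>i<n. A i) \<omega>)"
      by (auto simp: fun_eq_iff lessThan_Suc indicator_def)
    then show ?case
      using Suc by (simp add: add integrable_indicator)
  qed
  moreover have "(\<lambda>n. f (indicator (\<Union>i<n. A i))) \<longlonglongrightarrow> f (indicator (\<Union>i. A i))"
  proof (rule tendsto_dominated)
    show "(\<lambda>n. indicator (\<Union>i<n. A i) \<omega> :: real) \<longlonglongrightarrow> indicator (\<Union>i. A i) \<omega>" for \<omega>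
      by (rule LIMSEQ_indicator_UN)
    show "integrable M (\<lambda>_. 1::real)" by simp
  qed (auto intro!: integrable_indicator simp: indicator_def)
  ultimately show ?thesis by (simp add: sums_def)
qed

text \<open>The values of \<open>f\<close> on indicators form a measure below \<open>M\<close>,
  whose density represents \<open>f\<close> on indicators; linearity and L1 continuity extend this
  to integrable functions. The constant 1 in \<open>le_L1\<close> becomes the upper bound of
  \<open>Z\<close>.\<close>

theorem bounded_density:
  "\<exists>Z\<in>borel_measurable M. (\<forall>\<omega>. 0 \<le> Z \<omega> \<and> Z \<omega> \<le> 1) \<and>
    (\<forall>X. integrable M X \<longrightarrow> f X = (\<integral>\<omega>. Z \<omega> * X \<omega> \<partial>M))"
proof -
  have f_nonneg: "0 \<le> f (indicator A)" if "A \<in> sets M" for A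
    using integrable_indicator[OF that] by (intro nonneg) auto
  define N where "N = measure_of (space M) (sets M) (\<lambda>A. ennreal (f (indicator A)))"
  have sets_N: "sets N = sets M" by (simp add: N_def)
  have N: "emeasure N A = ennreal (f (indicator A))" if A: "A \<in> sets M" for A
    unfolding N_def
  proof (rule emeasure_measure_of_sigma[OF sets.sigma_algebra_axioms _ _ A])
    show "positive (sets M) (\<lambda>A. ennreal (f (indicator A)))"
      using scale[of "\<lambda>_. 0" 0] by (simp add: positive_def indicator_def[abs_def])
    show "countably_additive (sets M) (\<lambda>A. ennreal (f (indicator A)))"
    proof (rule countably_additiveI)
      fix A :: "nat \<Rightarrow> 'a set" assume A: "range A \<subseteq> sets M" "disjoint_family A"
      show "(\<Sum>i. ennreal (f (indicator (A i)))) = ennreal (f (indicator (\<Union>i. A i)))"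
        using A f_nonneg by (intro suminf_ennreal_eq sums_disjoint) auto
    qed
  qed
  have "\<exists>Z\<in>borel_measurable M. (\<forall>\<omega>. 0 \<le> Z \<omega> \<and> Z \<omega> \<le> (1::real)) \<and> N = density M Z"
  proof (rule measure_le_density[OF sets_N])
    show "emeasure N A \<le> emeasure M A" if A: "A \<in> sets M" for A
      using le_L1[OF integrable_indicator[OF A]] A by (simp add: N emeasure_eq_measure)
  qed
  then obtain Z :: "'a \<Rightarrow> real" where [measurable]: "Z \<in> borel_measurable M" and Z: "\<And>\<omega>. 0 \<le> Z \<omega>" "\<And>\<omega>. Z \<omega> \<le> 1"
    and NZ: "N = density M Z" by blast
  have int_Z: "integrable M (\<lambda>\<omega>. Z \<omega> * X \<omega>)" if "integrable M X" for X :: "'a \<Rightarrow> real"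
    by (rule Bochner_Integration.integrable_bound[OF that])
      (use that Z in \<open>auto simp: abs_mult intro!: mult_left_le_one_le\<close>)
  note f_add = add
  have "f X = (\<integral>\<omega>. Z \<omega> * X \<omega> \<partial>M)" if "integrable M X" for X
    using that
  proof (induction rule: integrable_induct)
    case (base A c)
    \<comment> \<open>Equality is first obtained between extended quantities; both sides are
      nonnegative reals, so it descends.\<close>
    have "ennreal (f (indicator A)) = (\<integral>\<^sup>+\<omega>. ennreal (Z \<omega>) * indicator A \<omega> \<partial>M)"
      using base by (simp add: N[symmetric] NZ emeasure_density)
    also have "\<dots> = (\<integral>\<^sup>+\<omega>. ennreal (Z \<omega> * indicator A \<omega>) \<partial>M)"
      by (intro nn_integral_cong) (simp add: indicator_def)
    also have "\<dots> = ennreal (\<integral>\<omega>. Z \<omega> * indicator A \<omega> \<partial>M)"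
      using base Z by (intro nn_integral_eq_integral int_Z integrable_indicator) auto
    finally have "f (indicator A) = (\<integral>\<omega>. Z \<omega> * indicator A \<omega> \<partial>M)"
      using f_nonneg base Z by (subst (asm) ennreal_inj) (auto intro!: integral_nonneg_AE)
    moreover have "f (\<lambda>\<omega>. indicator A \<omega> *\<^sub>R c) = c * f (indicator A)"
      using scale[OF integrable_indicator, of A c] base by (simp add: mult.commute)
    moreover have "(\<integral>\<omega>. Z \<omega> * (indicator A \<omega> *\<^sub>R c) \<partial>M) = c * (\<integral>\<omega>. Z \<omega> * indicator A \<omega> \<partial>M)"
      by (subst integral_mult_right_zero[symmetric]) (simp add: ac_simps)
    ultimately show ?case by simp
  next
    case (add X Y)
    then show ?case by (simp add: f_add distrib_left int_Z)
  next
    case (lim X s)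
    \<comment> \<open>The induction rule supplies approximants bounded by twice the absolute value
      of \<open>X\<close>, the majorant for both limits.\<close>
    have "(\<lambda>i. f (s i)) \<longlonglongrightarrow> f X"
      using lim by (intro tendsto_dominated[where w="\<lambda>\<omega>. 2 * \<bar>X \<omega>\<bar>"]) auto
    moreover have "(\<lambda>i. \<integral>\<omega>. Z \<omega> * s i \<omega> \<partial>M) \<longlonglongrightarrow> (\<integral>\<omega>. Z \<omega> * X \<omega> \<partial>M)"
    proof (rule integral_dominated_convergence[where w="\<lambda>\<omega>. 2 * \<bar>X \<omega>\<bar>"])
      show "AE \<omega> in M. (\<lambda>i. Z \<omega> * s i \<omega>) \<longlonglongrightarrow> Z \<omega> * X \<omega>"
        using lim by (auto intro!: AE_I2 tendsto_mult_left)
      show "AE \<omega> in M. norm (Z \<omega> * s i \<omega>) \<le> 2 * \<bar>X \<omega>\<bar>" for i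
      proof (rule AE_I2)
        fix \<omega> assume "\<omega> \<in> space M"
        have "norm (Z \<omega> * s i \<omega>) \<le> \<bar>s i \<omega>\<bar>"
          using Z by (auto simp: abs_mult intro!: mult_left_le_one_le)
        also have "\<dots> \<le> 2 * \<bar>X \<omega>\<bar>" using lim \<open>\<omega> \<in> space M\<close> by simp
        finally show "norm (Z \<omega> * s i \<omega>) \<le> 2 * \<bar>X \<omega>\<bar>" .
      qed
    qed (use lim in auto)
    ultimately show ?case
      using lim by (simp add: LIMSEQ_unique)
  qed
  then show ?thesis using Z by (intro bexI[of _ Z]) auto
qed

end

section \<open>Separation and exhaustion\<close>

lemma L1_dist_commute: "L1_dist M X Y = L1_dist M Y X"
  by (simp add: L1_dist_def abs_minus_commute)

lemma subspace_payoffs: "subspace (payoffs M)"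
  by (auto simp: subspace_def payoffs_def zero_fun_def plus_fun_def scaleR_fun_def)

lemma sublinear_L1_norm: "sublinear_on (payoffs M) (\<lambda>X. \<integral>\<omega>. \<bar>X \<omega>\<bar> \<partial>M)"
proof (rule sublinear_onI)
  fix X Y assume "X \<in> payoffs M" "Y \<in> payoffs M"
  then have "(\<integral>\<omega>. \<bar>(X + Y) \<omega>\<bar> \<partial>M) \<le> (\<integral>\<omega>. \<bar>X \<omega>\<bar> + \<bar>Y \<omega>\<bar> \<partial>M)"
    by (intro integral_mono) (auto simp: payoffs_def)
  also have "\<dots> = (\<integral>\<omega>. \<bar>X \<omega>\<bar> \<partial>M) + (\<integral>\<omega>. \<bar>Y \<omega>\<bar> \<partial>M)"
    using \<open>X \<in> payoffs M\<close> \<open>Y \<in> payoffs M\<close> by (simp add: payoffs_def)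
  finally show "(\<integral>\<omega>. \<bar>(X + Y) \<omega>\<bar> \<partial>M) \<le> (\<integral>\<omega>. \<bar>X \<omega>\<bar> \<partial>M) + (\<integral>\<omega>. \<bar>Y \<omega>\<bar> \<partial>M)" .
qed (simp add: abs_mult)

text \<open>The cone \<open>D\<close> contains \<open>I\<close> as well as the negative of each
  nonnegative payoff. So a linear functional below the distance from \<open>D\<close> is nonpositive
  on \<open>I\<close> and nonnegative on nonnegative payoffs at once; choosing contact at
  \<open>R\<close> makes its value there at least \<open>r\<close>.\<close>

lemma (in finite_measure) separating_density:
  assumes I: "I \<subseteq> payoffs M" "(\<lambda>_. 0) \<in> I"
    and I_add: "\<And>X Y. X \<in> I \<Longrightarrow> Y \<in> I \<Longrightarrow> (\<lambda>\<omega>. X \<omega> + Y \<omega>) \<in> I"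
    and I_scale: "\<And>c X. c > 0 \<Longrightarrow> X \<in> I \<Longrightarrow> (\<lambda>\<omega>. c * X \<omega>) \<in> I"
    and R: "R \<in> payoffs M" and r: "r > 0"
    and dist: "\<And>X Y. X \<in> I \<Longrightarrow> Y \<in> payoffs M \<Longrightarrow> (\<And>\<omega>. 0 \<le> Y \<omega>) \<Longrightarrow>
      r \<le> L1_dist M R (\<lambda>\<omega>. X \<omega> - Y \<omega>)"
  shows "\<exists>Z\<in>borel_measurable M. (\<forall>\<omega>. 0 \<le> Z \<omega> \<and> Z \<omega> \<le> 1) \<and>
    (\<forall>X\<in>I. (\<integral>\<omega>. Z \<omega> * X \<omega> \<partial>M) \<le> 0) \<and> 0 < (\<integral>\<omega>. Z \<omega> * R \<omega> \<partial>M)"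
proof -
  let ?n = "\<lambda>X. \<integral>\<omega>. \<bar>X \<omega>\<bar> \<partial>M"
  define D where "D = {(\<lambda>\<omega>. X \<omega> - Y \<omega>) | X Y. X \<in> I \<and> Y \<in> payoffs M \<and> (\<forall>\<omega>. 0 \<le> Y \<omega>)}"
  have D_I: "(\<lambda>\<omega>. X \<omega> - Y \<omega>) \<in> D" if "X \<in> I" "Y \<in> payoffs M" "\<And>\<omega>. 0 \<le> Y \<omega>" for X Y
    using that unfolding D_def by blast
  have ID: "X \<in> D" if "X \<in> I" for X
    using D_I[OF that, of "\<lambda>_. 0"] by (simp add: payoffs_def)
  have D_payoffs: "D \<subseteq> payoffs M"
    using I by (auto simp: D_def payoffs_def)
  have D_add: "d + e \<in> D" if d: "d \<in> D" and e: "e \<in> D" for d e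
  proof -
    obtain X Y where X: "d = (\<lambda>\<omega>. X \<omega> - Y \<omega>)" "X \<in> I" "Y \<in> payoffs M" "\<And>\<omega>. 0 \<le> Y \<omega>"
      using d unfolding D_def by blast
    obtain X' Y' where X': "e = (\<lambda>\<omega>. X' \<omega> - Y' \<omega>)" "X' \<in> I" "Y' \<in> payoffs M" "\<And>\<omega>. 0 \<le> Y' \<omega>"
      using e unfolding D_def by blast
    have "(\<lambda>\<omega>. (X \<omega> + X' \<omega>) - (Y \<omega> + Y' \<omega>)) \<in> D"
      using X X' by (intro D_I I_add) (auto simp: payoffs_def)
    then show ?thesis by (simp add: X X' plus_fun_def algebra_simps)
  qed
  have D_scale: "c *\<^sub>R d \<in> D" if c: "c > 0" and d: "d \<in> D" for c d
  proof -
    obtain X Y where X: "d = (\<lambda>\<omega>. X \<omega> - Y \<omega>)" "X \<in> I" "Y \<in> payoffs M" "\<And>\<omega>. 0 \<le> Y \<omega>"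
      using d unfolding D_def by blast
    have "(\<lambda>\<omega>. c * X \<omega> - c * Y \<omega>) \<in> D"
      using X c by (intro D_I I_scale) (auto simp: payoffs_def)
    then show ?thesis by (simp add: X scaleR_fun_def algebra_simps)
  qed
  have D0: "0 \<in> D" using ID[OF I(2)] by (simp add: zero_fun_def)
  define p where "p = (\<lambda>X. INF d\<in>D. ?n (X - d))"
  have sub_p: "sublinear_on (payoffs M) p"
    and p_le: "\<And>X d. X \<in> payoffs M \<Longrightarrow> d \<in> D \<Longrightarrow> p X \<le> ?n (X - d)"
    unfolding p_def
    by (rule sublinear_cone_distance[OF subspace_payoffs sublinear_L1_norm _ D_payoffs D0 D_add D_scale];
        simp)+
  obtain f where f_add: "\<forall>X\<in>payoffs M. \<forall>Y\<in>payoffs M. f (X + Y) = f X + f Y"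
    and f_scale: "\<forall>c. \<forall>X\<in>payoffs M. f (c *\<^sub>R X) = c * f X"
    and f_le: "\<forall>X\<in>payoffs M. f X \<le> p X" and f_R: "f R = p R"
    using dominated_linear_functional[OF subspace_payoffs sub_p R] by blast
  \<comment> \<open>A point of the cone has distance at most 0 from it.\<close>
  have f_D: "f d \<le> 0" if "d \<in> D" for d
    using f_le p_le[of d d] that D_payoffs by fastforce
  interpret L1_functional M f
  proof
    fix X Y :: "'a \<Rightarrow> real" and c :: real assume X: "integrable M X"
    show "f (\<lambda>\<omega>. X \<omega> + Y \<omega>) = f X + f Y" if "integrable M Y"
      using f_add X that by (simp add: payoffs_def plus_fun_def)
    show fc: "f (\<lambda>\<omega>. c * X \<omega>) = c * f X" for c
      using f_scale X by (simp add: payoffs_def scaleR_fun_def)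
    \<comment> \<open>Comparison with the cone element 0 gives the norm bound.\<close>
    show "f X \<le> ?n X"
      using f_le p_le[OF _ D0, of X] X by (auto simp: payoffs_def intro: order_trans)
    \<comment> \<open>The function \<open>- X\<close> lies in the cone, being 0 minus a nonnegative
      payoff.\<close>
    show "0 \<le> f X" if "\<And>\<omega>. 0 \<le> X \<omega>"
      using f_D[OF D_I[OF I(2), of X]] fc[of "- 1"] X that by (simp add: payoffs_def)
  qed
  obtain Z where Z: "Z \<in> borel_measurable M" "\<forall>\<omega>. 0 \<le> Z \<omega> \<and> Z \<omega> \<le> 1"
    and f_eq: "\<And>X. integrable M X \<Longrightarrow> f X = (\<integral>\<omega>. Z \<omega> * X \<omega> \<partial>M)"
    using bounded_density by blast
  have "(\<integral>\<omega>. Z \<omega> * X \<omega> \<partial>M) \<le> 0" if "X \<in> I" for X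
    using f_D[OF ID[OF that]] f_eq[of X] I that by (auto simp: payoffs_def)
  moreover have "r \<le> p R"
    unfolding p_def
  proof (rule cINF_greatest)
    fix d assume "d \<in> D"
    then show "r \<le> ?n (R - d)"
      using dist by (auto simp: D_def L1_dist_def)
  qed (use D0 in auto)
  then have "0 < (\<integral>\<omega>. Z \<omega> * R \<omega> \<partial>M)"
    using f_R f_eq[of R] R r by (simp add: payoffs_def)
  ultimately show ?thesis using Z by (intro bexI[of _ Z]) auto
qed

section \<open>Countable convex combinations of densities\<close>

definition dyadic_mixture :: "(nat \<Rightarrow> 'a \<Rightarrow> real) \<Rightarrow> 'a \<Rightarrow> real" where
  "dyadic_mixture Z \<omega> = (\<Sum>n. (1/2) ^ Suc n * Z n \<omega>)"

context
  fixes Z :: "nat \<Rightarrow> 'a \<Rightarrow> real"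
  assumes Z: "\<And>n \<omega>. 0 \<le> Z n \<omega>" "\<And>n \<omega>. Z n \<omega> \<le> 1"
begin

lemma summable_dyadic_mixture: "summable (\<lambda>n. (1/2) ^ Suc n * Z n \<omega>)"
  using Z
  by (intro summable_comparison_test'[OF sums_summable[OF power_half_series], of 0])
     (simp add: mult_left_le)

lemma dyadic_mixture_nonneg: "0 \<le> dyadic_mixture Z \<omega>"
  unfolding dyadic_mixture_def using Z by (intro suminf_nonneg summable_dyadic_mixture) simp

text \<open>The exponents start at 1, so the weights sum to exactly 1.\<close>

lemma dyadic_mixture_le_1: "dyadic_mixture Z \<omega> \<le> 1"
proof -
  have "dyadic_mixture Z \<omega> \<le> (\<Sum>n. (1/2) ^ Suc n)"
    unfolding dyadic_mixture_def
    using Z by (intro suminf_le summable_dyadic_mixture sums_summable[OF power_half_series])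
      (simp add: mult_left_le)
  also have "\<dots> = 1" by (rule sums_unique[OF power_half_series, symmetric])
  finally show ?thesis .
qed

text \<open>One positive term suffices, so a mixture is positive on the union of the supports;
  exhaustion rests on this.\<close>

lemma dyadic_mixture_pos: "0 < Z n \<omega> \<Longrightarrow> 0 < dyadic_mixture Z \<omega>"
  unfolding dyadic_mixture_def using Z by (intro suminf_pos2[where i=n] summable_dyadic_mixture) auto

text \<open>Sum and integral may be exchanged because each term is bounded by its weight times the
  absolute value of \<open>X\<close>; afterwards every term is nonpositive.\<close>

lemma integral_dyadic_mixture_nonpos:
  assumes [measurable]: "\<And>n. Z n \<in> borel_measurable M" and X: "integrable M X"
    and le: "\<And>n. (\<integral>\<omega>. Z n \<omega> * X \<omega> \<partial>M) \<le> 0"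
  shows "(\<integral>\<omega>. dyadic_mixture Z \<omega> * X \<omega> \<partial>M) \<le> 0"
proof -
  let ?g = "\<lambda>n \<omega>. (1/2) ^ Suc n * Z n \<omega> * X \<omega>"
  have ZX: "\<bar>Z n \<omega> * X \<omega>\<bar> \<le> \<bar>X \<omega>\<bar>" for n \<omega>
    using Z by (auto simp: abs_mult intro!: mult_left_le_one_le)
  have int_ZX: "integrable M (\<lambda>\<omega>. Z n \<omega> * X \<omega>)" for n
    by (rule Bochner_Integration.integrable_bound[OF X]) (use X ZX in auto)
  have int: "integrable M (?g n)" for n
    using integrable_mult_right[OF int_ZX, of "(1/2) ^ Suc n" n] by (simp add: mult.assoc)
  have norm_g: "norm (?g n \<omega>) \<le> (1/2) ^ Suc n * \<bar>X \<omega>\<bar>" for n \<omega>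
    using mult_left_mono[OF ZX[of n \<omega>], of "(1/2) ^ Suc n"] by (simp add: abs_mult mult.assoc)
  have "dyadic_mixture Z \<omega> * X \<omega> = (\<Sum>n. ?g n \<omega>)" for \<omega>
    unfolding dyadic_mixture_def by (rule suminf_mult2[OF summable_dyadic_mixture])
  then have "(\<integral>\<omega>. dyadic_mixture Z \<omega> * X \<omega> \<partial>M) = (\<integral>\<omega>. (\<Sum>n. ?g n \<omega>) \<partial>M)"
    by presburger
  also have "\<dots> = (\<Sum>n. \<integral>\<omega>. ?g n \<omega> \<partial>M)"
  proof (rule integral_suminf[OF int])
    have "summable (\<lambda>n. norm (?g n \<omega>))" for \<omega>
      using norm_g
      by (intro summable_comparison_test'[OF summable_mult2[OF sums_summable[OF power_half_series]], of 0]) auto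
    then show "AE \<omega> in M. summable (\<lambda>n. norm (?g n \<omega>))" by simp
    have "(\<integral>\<omega>. norm (?g n \<omega>) \<partial>M) \<le> (1/2) ^ Suc n * (\<integral>\<omega>. \<bar>X \<omega>\<bar> \<partial>M)" for n
      unfolding integral_mult_right_zero[symmetric]
      using norm_g X by (intro integral_mono[OF integrable_norm[OF int]]) auto
    then show "summable (\<lambda>n. \<integral>\<omega>. norm (?g n \<omega>) \<partial>M)"
      by (intro summable_comparison_test'[OF summable_mult2[OF sums_summable[OF power_half_series]], of 0])
         simp
  qed
  also have "\<dots> \<le> (\<Sum>n. 0)"
  proof (rule suminf_le)
    show "(\<integral>\<omega>. ?g n \<omega> \<partial>M) \<le> 0" for n
      using le[of n] by (simp add: mult.assoc mult_nonneg_nonpos)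
    have "norm (\<integral>\<omega>. ?g n \<omega> \<partial>M) \<le> (1/2) ^ Suc n * (\<integral>\<omega>. \<bar>X \<omega>\<bar> \<partial>M)" for n
    proof -
      have "norm (\<integral>\<omega>. ?g n \<omega> \<partial>M) \<le> (\<integral>\<omega>. (1/2) ^ Suc n * \<bar>X \<omega>\<bar> \<partial>M)"
        using norm_g int X by (intro order_trans[OF integral_norm_bound] integral_mono[OF integrable_norm[OF int]]) auto
      then show ?thesis by simp
    qed
    then show "summable (\<lambda>n. \<integral>\<omega>. ?g n \<omega> \<partial>M)"
      by (intro summable_comparison_test'[OF summable_mult2[OF sums_summable[OF power_half_series]], of 0])
         simp
  qed simp
  finally show ?thesis by simp
qed

end

lemma borel_measurable_dyadic_mixture [measurable]:
  assumes [measurable]: "\<And>n. Z n \<in> borel_measurable M"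
  shows "dyadic_mixture Z \<in> borel_measurable M"
  unfolding dyadic_mixture_def[abs_def] by measurable

text \<open>The supremum of the masses of supports is attained by mixing near-optimal functions. If
  the zero set of this mixture had positive mass, mixing in a function that charges it would exceed
  the supremum.\<close>

lemma (in finite_measure) exhaustion:
  assumes C: "C \<subseteq> borel_measurable M" "C \<noteq> {}"
    and C_bounds: "\<And>Z \<omega>. Z \<in> C \<Longrightarrow> 0 \<le> Z \<omega> \<and> Z \<omega> \<le> (1::real)"
    and C_mix: "\<And>Z. range Z \<subseteq> C \<Longrightarrow> dyadic_mixture Z \<in> C"
    and C_pos: "\<And>A. A \<in> sets M \<Longrightarrow> measure M A > 0 \<Longrightarrow> \<exists>Z\<in>C. 0 < (\<integral>\<omega>. Z \<omega> * indicator A \<omega> \<partial>M)"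
  shows "\<exists>Z\<in>C. AE \<omega> in M. 0 < Z \<omega>"
proof -
  define supp where "supp Z = {\<omega>\<in>space M. (0::real) < Z \<omega>}" for Z
  have supp_sets: "supp Z \<in> sets M" if "Z \<in> C" for Z
    using C that unfolding supp_def by (auto intro!: measurable_sets_Collect borel_measurable_less)
  define s where "s = (SUP Z\<in>C. measure M (supp Z))"
  have le_s: "measure M (supp Z) \<le> s" if "Z \<in> C" for Z
    unfolding s_def using that by (intro cSUP_upper bdd_aboveI2[of _ _ "measure M (space M)"]) (auto simp: bounded_measure)
  have "\<exists>Z\<in>C. s - inverse (Suc n) < measure M (supp Z)" for n
    unfolding s_def using C
    by (subst less_cSUP_iff[symmetric])
       (auto intro!: bdd_aboveI2[of _ _ "measure M (space M)"] simp: bounded_measure)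
  then obtain Z where ZC: "\<And>n. Z n \<in> C" and Z: "\<And>n. s - inverse (Suc n) < measure M (supp (Z n))"
    by metis
  let ?Z = "dyadic_mixture Z"
  have mix: "?Z \<in> C" using ZC by (intro C_mix) auto
  have "measure M (supp (Z n)) \<le> measure M (supp ?Z)" for n
    using ZC C_bounds dyadic_mixture_pos[of Z n]
    by (intro finite_measure_mono supp_sets mix) (auto simp: supp_def)
  then have "s - inverse (Suc n) \<le> measure M (supp ?Z)" for n
    using Z by (meson less_imp_le order_trans)
  moreover have "(\<lambda>n. s - inverse (real (Suc n))) \<longlonglongrightarrow> s - 0"
    by (intro tendsto_intros LIMSEQ_inverse_real_of_nat)
  ultimately have s_le: "s \<le> measure M (supp ?Z)"
    by (intro LIMSEQ_le_const2[of _ s]) auto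
  define A where "A = space M - supp ?Z"
  have A[measurable]: "A \<in> sets M" unfolding A_def using supp_sets[OF mix] by auto
  have "measure M A = 0"
  proof (rule ccontr)
    assume "measure M A \<noteq> 0"
    then obtain Y where Y: "Y \<in> C" "0 < (\<integral>\<omega>. Y \<omega> * indicator A \<omega> \<partial>M)"
      using C_pos[OF A] by (auto simp: less_le)
    \<comment> \<open>If \<open>Y\<close> were positive only on a null part of \<open>A\<close>, its
      integral over \<open>A\<close> would vanish.\<close>
    have pos: "0 < measure M (supp Y \<inter> A)"
    proof (rule ccontr)
      assume "\<not> 0 < measure M (supp Y \<inter> A)"
      then have "supp Y \<inter> A \<in> null_sets M"
        using supp_sets[OF Y(1)] by (auto simp: emeasure_eq_measure less_le)
      then have "AE \<omega> in M. Y \<omega> * indicator A \<omega> = 0"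
        by (rule AE_I') (use C_bounds[OF Y(1)] in \<open>auto simp: supp_def less_le indicator_def\<close>)
      then have "(\<integral>\<omega>. Y \<omega> * indicator A \<omega> \<partial>M) = 0"
        by (rule integral_eq_zero_AE)
      with Y show False by simp
    qed
    \<comment> \<open>Closure under mixtures is assumed for sequences, so the pair becomes a
      sequence with constant tail \<open>Y\<close>.\<close>
    define W where "W n = (if n = 0 then ?Z else Y)" for n :: nat
    have W: "range W \<subseteq> C" using mix Y by (auto simp: W_def)
    have W_bounds: "\<And>n \<omega>. 0 \<le> W n \<omega>" "\<And>n \<omega>. W n \<omega> \<le> 1" using W C_bounds by blast+
    have W_pos: "0 < dyadic_mixture W \<omega>" if "0 < W n \<omega>" for n \<omega>
      using W_bounds that by (rule dyadic_mixture_pos)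
    have "supp ?Z \<union> (supp Y \<inter> A) \<subseteq> supp (dyadic_mixture W)"
      using W_pos[of 0] W_pos[of 1] by (auto simp: supp_def W_def)
    then have "measure M (supp ?Z \<union> (supp Y \<inter> A)) \<le> measure M (supp (dyadic_mixture W))"
      using supp_sets[OF C_mix[OF W]] by (intro finite_measure_mono)
    also have "\<dots> \<le> s" by (rule le_s[OF C_mix[OF W]])
    also have "measure M (supp ?Z \<union> (supp Y \<inter> A)) = measure M (supp ?Z) + measure M (supp Y \<inter> A)"
      using supp_sets[OF mix] supp_sets[OF Y(1)] by (intro finite_measure_Union) (auto simp: A_def)
    finally show False using pos s_le by simp
  qed
  then have "A \<in> null_sets M" by (auto simp: emeasure_eq_measure)
  then have "AE \<omega> in M. 0 < ?Z \<omega>"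
    by (rule AE_I') (auto simp: A_def supp_def)
  with mix show ?thesis by blast
qed

section \<open>Net trades, agents and martingale measures\<close>

lemma zero_in_net_trades: "(\<lambda>_. 0) \<in> net_trades M T F S"
  unfolding net_trades_def payoffs_def by (auto intro!: exI[of _ "\<lambda>_ _. 0"])

lemma add_in_net_trades:
  assumes "X \<in> net_trades M T F S" "Y \<in> net_trades M T F S"
  shows "(\<lambda>\<omega>. X \<omega> + Y \<omega>) \<in> net_trades M T F S"
proof -
  obtain H K where
    "\<forall>t\<in>{1..T}. H t \<in> borel_measurable (F (t - 1))"
    "\<forall>\<omega>\<in>space M. X \<omega> = (\<Sum>t = 1..T. H t \<omega> \<bullet> (S t \<omega> - S (t - 1) \<omega>))"
    "\<forall>t\<in>{1..T}. K t \<in> borel_measurable (F (t - 1))"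
    "\<forall>\<omega>\<in>space M. Y \<omega> = (\<Sum>t = 1..T. K t \<omega> \<bullet> (S t \<omega> - S (t - 1) \<omega>))"
    using assms unfolding net_trades_def by blast
  then show ?thesis
    using assms unfolding net_trades_def payoffs_def
    by (auto intro!: exI[of _ "\<lambda>t \<omega>. H t \<omega> + K t \<omega>"] borel_measurable_add
        simp: inner_add_left sum.distrib)
qed

lemma scale_in_net_trades:
  assumes "X \<in> net_trades M T F S"
  shows "(\<lambda>\<omega>. c * X \<omega>) \<in> net_trades M T F S"
proof -
  obtain H where
    "\<forall>t\<in>{1..T}. H t \<in> borel_measurable (F (t - 1))"
    "\<forall>\<omega>\<in>space M. X \<omega> = (\<Sum>t = 1..T. H t \<omega> \<bullet> (S t \<omega> - S (t - 1) \<omega>))"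
    using assms unfolding net_trades_def by blast
  then show ?thesis
    using assms unfolding net_trades_def payoffs_def
    by (auto intro!: exI[of _ "\<lambda>t \<omega>. c *\<^sub>R H t \<omega>"] borel_measurable_scaleR
        simp: sum_distrib_left)
qed

section \<open>Consequences of the axioms for agents\<close>

lemma agents_mono:
  assumes "pref \<in> agents M" "X \<in> payoffs M" "Y \<in> payoffs M" "as_le M X Y"
  shows "pref X Y"
proof -
  have "\<forall>X\<in>payoffs M. \<forall>Y\<in>payoffs M. as_le M X Y \<longrightarrow> pref X Y"
    using assms(1) unfolding agents_def mem_Collect_eq by (elim conjE)
  from this[THEN bspec[of _ _ X], THEN bspec[of _ _ Y]] show ?thesis using assms(2-) by simp
qed

lemma agents_trans:
  assumes "pref \<in> agents M" "X \<in> payoffs M" "Y \<in> payoffs M" "Z \<in> payoffs M" "pref X Y" "pref Y Z"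
  shows "pref X Z"
proof -
  have "\<forall>X\<in>payoffs M. \<forall>Y\<in>payoffs M. \<forall>Z\<in>payoffs M. pref X Y \<longrightarrow> pref Y Z \<longrightarrow> pref X Z"
    using assms(1) unfolding agents_def mem_Collect_eq by (elim conjE)
  from this[THEN bspec[of _ _ X], THEN bspec[of _ _ Y], THEN bspec[of _ _ Z]]
  show ?thesis using assms(2-) by simp
qed

lemma agents_lsc:
  assumes pref: "pref \<in> agents M" and "\<And>n. Xs n \<in> payoffs M" "X \<in> payoffs M" "Y \<in> payoffs M"
    and "L1_tendsto M Xs X" "\<And>n. pref (Xs n) Y"
  shows "pref X Y"
proof -
  have lsc: "\<forall>Xs X Y. range Xs \<subseteq> payoffs M \<longrightarrow> X \<in> payoffs M \<longrightarrow> Y \<in> payoffs M \<longrightarrow>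
      L1_tendsto M Xs X \<longrightarrow> (\<forall>n. pref (Xs n) Y) \<longrightarrow> pref X Y"
    using pref unfolding agents_def mem_Collect_eq by (elim conjE)
  have "range Xs \<subseteq> payoffs M" using assms(2) by blast
  then show ?thesis
    using lsc[THEN spec[of _ Xs], THEN spec[of _ X], THEN spec[of _ Y]] assms(3-) by simp
qed

text \<open>Sequential lower semicontinuity in contrapositive form: otherwise payoffs weakly below
  \<open>Y\<close> at distances less than \<open>inverse (real (Suc n))\<close> would converge to
  \<open>X\<close> and put \<open>X\<close> weakly below \<open>Y\<close>.\<close>

lemma agent_strict_preference_open:
  assumes pref: "pref \<in> agents M" and X: "X \<in> payoffs M" and Y: "Y \<in> payoffs M"
    and "\<not> pref X Y"
  shows "\<exists>r>0. \<forall>X'\<in>payoffs M. pref X' Y \<longrightarrow> r \<le> L1_dist M X' X"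
proof (rule ccontr)
  assume "\<not> ?thesis"
  then have no_ball: "\<not> (\<forall>X'\<in>payoffs M. pref X' Y \<longrightarrow> r \<le> L1_dist M X' X)" if "r > 0" for r
    using that by simp
  have "\<exists>X'. X' \<in> payoffs M \<and> pref X' Y \<and> L1_dist M X' X < inverse (real (Suc n))" for n
    using no_ball[of "inverse (real (Suc n))"] by (simp add: not_le Bex_def)
  then obtain Xs where Xs: "\<And>n. Xs n \<in> payoffs M" "\<And>n. pref (Xs n) Y"
    and dist: "\<And>n. L1_dist M (Xs n) X < inverse (real (Suc n))"
    by metis
  have "L1_tendsto M Xs X"
    unfolding L1_tendsto_def
  proof (rule tendsto_sandwich[OF _ _ tendsto_const LIMSEQ_inverse_real_of_nat])
    show "\<forall>\<^sub>F n in sequentially. 0 \<le> L1_dist M (Xs n) X" by (simp add: L1_dist_def)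
    show "\<forall>\<^sub>F n in sequentially. L1_dist M (Xs n) X \<le> inverse (real (Suc n))"
      using dist by (simp add: less_imp_le)
  qed
  with pref Xs(1) X Y have "pref X Y" using Xs(2)
    by (rule agents_lsc[where pref=pref])
  with \<open>\<not> pref X Y\<close> show False by simp
qed

text \<open>Each event of positive probability is charged by some density, obtained from an agent
  who strictly prefers its indicator to 0; exhaustion merges these into one.\<close>

lemma (in prob_space) viable_imp_density:
  assumes I: "I \<subseteq> payoffs M" "(\<lambda>_. 0) \<in> I"
    and I_add: "\<And>X Y. X \<in> I \<Longrightarrow> Y \<in> I \<Longrightarrow> (\<lambda>\<omega>. X \<omega> + Y \<omega>) \<in> I"
    and I_scale: "\<And>c X. c > 0 \<Longrightarrow> X \<in> I \<Longrightarrow> (\<lambda>\<omega>. c * X \<omega>) \<in> I"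
    and viable: "viable M I"
  shows "\<exists>Z\<in>borel_measurable M. (\<forall>\<omega>. 0 \<le> Z \<omega> \<and> Z \<omega> \<le> 1) \<and> (AE \<omega> in M. 0 < Z \<omega>) \<and>
    (\<forall>X\<in>I. (\<integral>\<omega>. Z \<omega> * X \<omega> \<partial>M) \<le> 0)"
proof -
  obtain A where A: "A \<subseteq> agents M" and opt: "\<forall>pref\<in>A. \<forall>X\<in>I. pref X (\<lambda>_. 0)"
    and rel: "\<forall>R\<in>relevant M. \<exists>pref\<in>A. strictly_prefers pref (\<lambda>_. 0) R"
    using viable unfolding viable_def by (elim exE conjE) simp
  have zero: "(\<lambda>_. 0) \<in> payoffs M" by (simp add: payoffs_def)
  \<comment> \<open>Densities are left unnormalised here: \<open>C\<close> contains the zero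
    function, and only signs of integrals matter.\<close>
  define C where "C = {Z \<in> borel_measurable M. (\<forall>\<omega>. 0 \<le> Z \<omega> \<and> Z \<omega> \<le> 1) \<and>
    (\<forall>X\<in>I. (\<integral>\<omega>. Z \<omega> * X \<omega> \<partial>M) \<le> 0)}"
  have "\<exists>Z\<in>C. AE \<omega> in M. 0 < Z \<omega>"
  proof (rule exhaustion)
    have "(\<lambda>_. 0) \<in> C" by (simp add: C_def)
    then show "C \<noteq> {}" by blast
  next
    fix Z :: "nat \<Rightarrow> 'a \<Rightarrow> real" assume "range Z \<subseteq> C"
    then have Z: "\<And>n. Z n \<in> borel_measurable M" "\<And>n \<omega>. 0 \<le> Z n \<omega>" "\<And>n \<omega>. Z n \<omega> \<le> 1"
      "\<And>n X. X \<in> I \<Longrightarrow> (\<integral>\<omega>. Z n \<omega> * X \<omega> \<partial>M) \<le> 0"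
      unfolding C_def by auto
    show "dyadic_mixture Z \<in> C"
      unfolding C_def
      using Z I dyadic_mixture_nonneg[OF Z(2,3)] dyadic_mixture_le_1[OF Z(2,3)]
      by (auto intro!: integral_dyadic_mixture_nonpos borel_measurable_dyadic_mixture simp: payoffs_def)
  next
    fix B assume B[measurable]: "B \<in> sets M" and pos: "measure M B > 0"
    let ?R = "indicator B :: 'a \<Rightarrow> real"
    have R: "?R \<in> payoffs M"
      by (simp add: payoffs_def integrable_real_indicator emeasure_eq_measure)
    have "{\<omega> \<in> space M. ?R \<omega> > 0} = B"
      using sets.sets_into_space[OF B] by (auto simp: indicator_def split: if_splits)
    then have "?R \<in> relevant M"
      using pos R by (simp add: relevant_def as_le_def)
    with rel obtain pref where pref_A: "pref \<in> A" and strict: "strictly_prefers pref (\<lambda>_. 0) ?R"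
      by (elim bspec[elim_format] bexE) simp
    have pref: "pref \<in> agents M" using pref_A A by (rule subsetD[rotated])
    have "\<not> pref ?R (\<lambda>_. 0)" using strict by (simp add: strictly_prefers_def)
    from agent_strict_preference_open[where pref=pref, OF pref R zero this]
    obtain r where ball: "r > 0 \<and> (\<forall>X\<in>payoffs M. pref X (\<lambda>_. 0) \<longrightarrow> r \<le> L1_dist M X ?R)" ..
    from ball have r: "r > 0" ..
    have "\<exists>Z\<in>borel_measurable M. (\<forall>\<omega>. 0 \<le> Z \<omega> \<and> Z \<omega> \<le> 1) \<and>
      (\<forall>X\<in>I. (\<integral>\<omega>. Z \<omega> * X \<omega> \<partial>M) \<le> 0) \<and> 0 < (\<integral>\<omega>. Z \<omega> * ?R \<omega> \<partial>M)"
    proof (rule separating_density[OF I I_add I_scale R r])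
      fix X Y assume X: "X \<in> I" and Y: "Y \<in> payoffs M" "\<And>\<omega>. 0 \<le> Y \<omega>"
      have XY: "(\<lambda>\<omega>. X \<omega> - Y \<omega>) \<in> payoffs M" and XM: "X \<in> payoffs M"
        using X Y I by (auto simp: payoffs_def)
      \<comment> \<open>Monotonicity puts \<open>X - Y\<close> weakly below \<open>X\<close>,
        optimality of 0 puts \<open>X\<close> weakly below 0, and transitivity keeps the cone out of
        the ball around \<open>?R\<close>.\<close>
      have "as_le M (\<lambda>\<omega>. X \<omega> - Y \<omega>) X" using Y by (simp add: as_le_def)
      then have "pref (\<lambda>\<omega>. X \<omega> - Y \<omega>) X" by (rule agents_mono[where pref=pref, OF pref XY XM])
      moreover have "pref X (\<lambda>_. 0)" by (rule bspec[OF bspec[OF opt pref_A] X])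
      ultimately have "pref (\<lambda>\<omega>. X \<omega> - Y \<omega>) (\<lambda>_. 0)"
        by (rule agents_trans[where pref=pref, OF pref XY XM zero])
      then show "r \<le> L1_dist M ?R (\<lambda>\<omega>. X \<omega> - Y \<omega>)"
        by (subst L1_dist_commute) (rule ball[THEN conjunct2, rule_format, OF XY])
    qed
    then show "\<exists>Z\<in>C. 0 < (\<integral>\<omega>. Z \<omega> * indicator B \<omega> \<partial>M)"
      unfolding C_def by auto
  qed (auto simp: C_def)
  then show ?thesis unfolding C_def by blast
qed

text \<open>The bound \<open>b\<close> gives integrability against \<open>Z\<close> and a Lipschitz
  estimate; almost sure positivity of \<open>Z\<close> makes the expectation strictly
  positive.\<close>

lemma (in prob_space) density_martingale_measure:
  assumes Z[measurable]: "Z \<in> borel_measurable M" and Z0: "\<And>\<omega>. 0 \<le> Z \<omega>" and Zb: "\<And>\<omega>. Z \<omega> \<le> (b::real)"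
    and pos: "AE \<omega> in M. 0 < Z \<omega>" and one: "(\<integral>\<omega>. Z \<omega> \<partial>M) = 1"
    and I: "I \<subseteq> payoffs M" and le: "\<And>X. X \<in> I \<Longrightarrow> (\<integral>\<omega>. Z \<omega> * X \<omega> \<partial>M) \<le> 0"
  shows "martingale_measure M I (density M Z)"
proof -
  have int_ZX: "integrable M (\<lambda>\<omega>. Z \<omega> * X \<omega>)" if "integrable M X" for X :: "'a \<Rightarrow> real"
  proof (rule Bochner_Integration.integrable_bound)
    show "integrable M (\<lambda>\<omega>. b * X \<omega>)" using that by simp
    have "\<bar>Z \<omega>\<bar> \<le> \<bar>b\<bar>" for \<omega> using Z0[of \<omega>] Zb[of \<omega>] by simp
    then show "AE \<omega> in M. norm (Z \<omega> * X \<omega>) \<le> norm (b * X \<omega>)"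
      by (simp add: abs_mult mult_right_mono)
  qed (use that in auto)
  have E: "(\<integral>\<omega>. X \<omega> \<partial>density M Z) = (\<integral>\<omega>. Z \<omega> * X \<omega> \<partial>M)" if "integrable M X" for X :: "'a \<Rightarrow> real"
    using that Z0 by (subst integral_density) auto
  have b0: "0 \<le> b" using order_trans[OF Z0 Zb] .
  have int_Z: "integrable M Z" using int_ZX[of "\<lambda>_. 1"] by simp
  show ?thesis
    unfolding martingale_measure_def
  proof (intro conjI ballI)
    show "prob_space (density M Z)"
    proof
      show "emeasure (density M Z) (space (density M Z)) = 1"
        using nn_integral_eq_integral[OF int_Z] Z0 one
        by (simp add: emeasure_density cong: nn_integral_cong)
    qed
    show "sets (density M Z) = sets M" by simp
    show "integrable (density M Z) X" if "X \<in> payoffs M" for X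
      using that int_ZX[of X] Z0 by (simp add: payoffs_def integrable_density)
    show "L1_continuous M (\<lambda>X. \<integral>\<omega>. X \<omega> \<partial>density M Z)"
      unfolding L1_continuous_def
    proof (intro ballI allI impI)
      fix X and \<epsilon> :: real assume X: "X \<in> payoffs M" and \<epsilon>: "\<epsilon> > 0"
      \<comment> \<open>Dividing by \<open>b + 1\<close> keeps the radius positive from
        \<open>0 \<le> b\<close> alone.\<close>
      have "\<bar>(\<integral>\<omega>. X \<omega> \<partial>density M Z) - (\<integral>\<omega>. Y \<omega> \<partial>density M Z)\<bar> < \<epsilon>"
        if Y: "Y \<in> payoffs M" and d: "L1_dist M X Y < \<epsilon> / (b + 1)" for Y
      proof -
        have XY: "integrable M X" "integrable M Y" using X Y by (auto simp: payoffs_def)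
        have "(\<integral>\<omega>. X \<omega> \<partial>density M Z) - (\<integral>\<omega>. Y \<omega> \<partial>density M Z) = (\<integral>\<omega>. Z \<omega> * (X \<omega> - Y \<omega>) \<partial>M)"
          using XY int_ZX by (simp add: E right_diff_distrib)
        also have "\<bar>\<dots>\<bar> \<le> (\<integral>\<omega>. \<bar>Z \<omega> * (X \<omega> - Y \<omega>)\<bar> \<partial>M)"
          by (rule integral_abs_bound)
        also have "\<dots> \<le> (\<integral>\<omega>. b * \<bar>X \<omega> - Y \<omega>\<bar> \<partial>M)"
          using XY Z0 Zb int_ZX[of "\<lambda>\<omega>. X \<omega> - Y \<omega>"] int_ZX[of "\<lambda>\<omega>. \<bar>X \<omega> - Y \<omega>\<bar>"]
          by (intro integral_mono) (auto simp: abs_mult intro!: mult_right_mono)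
        also have "\<dots> = b * L1_dist M X Y" by (simp add: L1_dist_def)
        also have "\<dots> \<le> (b + 1) * L1_dist M X Y"
          by (intro mult_right_mono) (auto simp: L1_dist_def)
        also have "\<dots> < \<epsilon>" using d b0 by (simp add: field_simps)
        finally show ?thesis .
      qed
      then show "\<exists>\<delta>>0. \<forall>Y\<in>payoffs M. L1_dist M X Y < \<delta> \<longrightarrow>
          \<bar>(\<integral>\<omega>. X \<omega> \<partial>density M Z) - (\<integral>\<omega>. Y \<omega> \<partial>density M Z)\<bar> < \<epsilon>"
        using \<epsilon> b0 by (intro exI[of _ "\<epsilon> / (b + 1)"]) auto
    qed
    show "positive_functional M (\<lambda>X. \<integral>\<omega>. X \<omega> \<partial>density M Z)"
      unfolding positive_functional_def
    proof (intro conjI ballI impI)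
      fix X assume X: "X \<in> payoffs M"
      then have iX: "integrable M X" by (simp add: payoffs_def)
      have nn: "AE \<omega> in M. 0 \<le> Z \<omega> * X \<omega>" if "as_le M (\<lambda>_. 0) X"
        using that unfolding as_le_def by eventually_elim (simp add: Z0)
      show ge: "0 \<le> (\<integral>\<omega>. X \<omega> \<partial>density M Z)" if "as_le M (\<lambda>_. 0) X"
        using nn[OF that] by (simp add: E[OF iX] integral_nonneg_AE)
      assume 0: "as_le M (\<lambda>_. 0) X \<and> \<not> as_le M X (\<lambda>_. 0)"
      \<comment> \<open>A nonnegative product with zero integral vanishes almost surely; as
        \<open>Z\<close> is positive, \<open>X\<close> would vanish too.\<close>
      have "(\<integral>\<omega>. Z \<omega> * X \<omega> \<partial>M) \<noteq> 0"
      proof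
        assume "(\<integral>\<omega>. Z \<omega> * X \<omega> \<partial>M) = 0"
        then have "AE \<omega> in M. Z \<omega> * X \<omega> = 0"
          using integral_nonneg_eq_0_iff_AE[OF int_ZX[OF iX] nn] 0 by simp
        with pos have "as_le M X (\<lambda>_. 0)" unfolding as_le_def by eventually_elim simp
        with 0 show False by simp
      qed
      then show "0 < (\<integral>\<omega>. X \<omega> \<partial>density M Z)"
        using ge 0 by (simp add: E[OF iX] less_le)
    qed
    show "(\<integral>\<omega>. X \<omega> \<partial>density M Z) \<le> 0" if "X \<in> I" for X
      using le[OF that] I that E[of X] by (auto simp: payoffs_def)
  qed
qed

lemma L1_continuous_tendsto:
  assumes \<phi>: "L1_continuous M \<phi>" and Xs: "\<And>n. Xs n \<in> payoffs M" and X: "X \<in> payoffs M"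
    and lim: "L1_tendsto M Xs X"
  shows "(\<lambda>n. \<phi> (Xs n)) \<longlonglongrightarrow> \<phi> X"
proof (rule tendstoI)
  fix \<epsilon> :: real assume "\<epsilon> > 0"
  then obtain \<delta> where "\<delta> > 0"
    and \<delta>: "\<And>Y. Y \<in> payoffs M \<Longrightarrow> L1_dist M X Y < \<delta> \<Longrightarrow> \<bar>\<phi> X - \<phi> Y\<bar> < \<epsilon>"
    using \<phi> X unfolding L1_continuous_def by meson
  have "\<forall>\<^sub>F n in sequentially. L1_dist M (Xs n) X < \<delta>"
    using order_tendstoD(2)[OF lim[unfolded L1_tendsto_def] \<open>\<delta> > 0\<close>] .
  then show "\<forall>\<^sub>F n in sequentially. dist (\<phi> (Xs n)) (\<phi> X) < \<epsilon>"
    by eventually_elim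
      (metis \<delta> Xs L1_dist_commute dist_real_def abs_minus_commute)
qed

text \<open>Payoffs are ranked by expectation under \<open>Q\<close>: linearity gives convexity, L1
  continuity gives lower semicontinuity, and strict positivity makes every relevant payoff better
  than 0.\<close>

lemma martingale_measure_imp_viable:
  assumes Q: "martingale_measure M I Q"
  shows "viable M I"
proof -
  define pref where "pref X Y \<longleftrightarrow> (\<integral>\<omega>. X \<omega> \<partial>Q) \<le> (\<integral>\<omega>. Y \<omega> \<partial>Q)" for X Y :: "'a \<Rightarrow> real"
  have int: "\<And>X. X \<in> payoffs M \<Longrightarrow> integrable Q X"
    and cont: "L1_continuous M (\<lambda>X. \<integral>\<omega>. X \<omega> \<partial>Q)"
    and pos: "positive_functional M (\<lambda>X. \<integral>\<omega>. X \<omega> \<partial>Q)"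
    and le: "\<And>X. X \<in> I \<Longrightarrow> (\<integral>\<omega>. X \<omega> \<partial>Q) \<le> 0"
    using Q unfolding martingale_measure_def by auto
  have "pref \<in> agents M"
    unfolding agents_def mem_Collect_eq
  proof (intro conjI ballI allI impI)
    fix X Y assume X: "X \<in> payoffs M" and Y: "Y \<in> payoffs M"
    show "pref X Y \<or> pref Y X" by (auto simp: pref_def)
    show "pref X Z" if "pref X Y" "pref Y Z" for Z using that by (auto simp: pref_def)
    show "pref X Y" if "as_le M X Y"
    proof -
      \<comment> \<open>Positivity compares with 0 only, so monotonicity is read off from the
        difference.\<close>
      have "(\<lambda>\<omega>. Y \<omega> - X \<omega>) \<in> payoffs M" using X Y by (simp add: payoffs_def)
      then have "0 \<le> (\<integral>\<omega>. Y \<omega> - X \<omega> \<partial>Q)"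
        using pos that by (auto simp: positive_functional_def as_le_def)
      then show ?thesis using int X Y by (simp add: pref_def)
    qed
    show "pref X (\<lambda>\<omega>. u * Y \<omega> + (1 - u) * Z \<omega>)"
      if Z: "Z \<in> payoffs M" and u: "u \<in> {0..1}" and YZ: "pref X Y" "pref X Z" for Z u
    proof -
      have "(\<integral>\<omega>. X \<omega> \<partial>Q) = u * (\<integral>\<omega>. X \<omega> \<partial>Q) + (1 - u) * (\<integral>\<omega>. X \<omega> \<partial>Q)"
        by (simp add: algebra_simps)
      also have "\<dots> \<le> u * (\<integral>\<omega>. Y \<omega> \<partial>Q) + (1 - u) * (\<integral>\<omega>. Z \<omega> \<partial>Q)"
        using u YZ by (intro add_mono mult_left_mono) (auto simp: pref_def)
      finally show ?thesis using int Y Z by (simp add: pref_def)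
    qed
  next
    fix Xs X Y
    assume Xs: "range Xs \<subseteq> payoffs M" and X: "X \<in> payoffs M" and lim: "L1_tendsto M Xs X"
      and le: "\<forall>n. pref (Xs n) Y"
    have "(\<lambda>n. \<integral>\<omega>. Xs n \<omega> \<partial>Q) \<longlonglongrightarrow> (\<integral>\<omega>. X \<omega> \<partial>Q)"
      by (rule L1_continuous_tendsto[OF cont _ X lim]) (use Xs in auto)
    then show "pref X Y"
      using le unfolding pref_def by (intro LIMSEQ_le_const2) auto
  qed
  moreover have "pref X (\<lambda>_. 0)" if "X \<in> I" for X using le[OF that] by (simp add: pref_def)
  moreover have "strictly_prefers pref (\<lambda>_. 0) R" if R: "R \<in> relevant M" for R
  proof -
    have "\<not> as_le M R (\<lambda>_. 0)"
    proof
      assume "as_le M R (\<lambda>_. 0)"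
      then have "AE \<omega> in M. \<omega> \<notin> {\<omega> \<in> space M. R \<omega> > 0}"
        unfolding as_le_def by eventually_elim auto
      then have "measure M {\<omega> \<in> space M. R \<omega> > 0} = 0"
        by (simp add: measure_def emeasure_eq_0_AE)
      then show False using R by (simp add: relevant_def)
    qed
    then have "0 < (\<integral>\<omega>. R \<omega> \<partial>Q)"
      using pos R by (auto simp: positive_functional_def relevant_def)
    then show ?thesis by (simp add: strictly_prefers_def pref_def)
  qed
  ultimately show ?thesis
    unfolding viable_def by (intro exI[of _ "{pref}"]) auto
qed

theorem proposition3p2:
  fixes M :: "'a measure"
    and T :: nat
    and F :: "nat \<Rightarrow> 'a measure"
    and S :: "nat \<Rightarrow> 'a \<Rightarrow> real ^ 'J"
  assumes "prob_space M"
    and "price_model M T F S"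
  shows "viable M (net_trades M T F S) \<longleftrightarrow>
    (\<exists>Q. martingale_measure M (net_trades M T F S) Q \<and> has_bounded_density M Q)"
proof
  interpret prob_space M by fact
  let ?I = "net_trades M T F S"
  have I: "?I \<subseteq> payoffs M" by (auto simp: net_trades_def)
  assume "viable M ?I"
  from viable_imp_density[OF I zero_in_net_trades add_in_net_trades scale_in_net_trades this]
  obtain Z where Z[measurable]: "Z \<in> borel_measurable M"
    and bounds: "\<And>\<omega>. 0 \<le> Z \<omega>" "\<And>\<omega>. Z \<omega> \<le> 1" and pos: "AE \<omega> in M. 0 < Z \<omega>"
    and le: "\<And>X. X \<in> ?I \<Longrightarrow> (\<integral>\<omega>. Z \<omega> * X \<omega> \<partial>M) \<le> 0"
    by blast
  have int: "integrable M Z"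
    using bounds by (intro integrable_const_bound[of _ 1]) auto
  \<comment> \<open>Otherwise \<open>Z\<close> would be both zero and positive almost surely,
    impossible on a probability space.\<close>
  have "expectation Z \<noteq> 0"
  proof
    assume "expectation Z = 0"
    then have "AE \<omega> in M. Z \<omega> = 0"
      using integral_nonneg_eq_0_iff_AE[OF int] bounds by simp
    with pos have "AE \<omega> in M. False" by eventually_elim simp
    then show False by simp
  qed
  then have EZ: "0 < expectation Z" using bounds by (simp add: less_le integral_nonneg_AE)
  \<comment> \<open>Normalisation gives total mass 1 and preserves the sign conditions; the bound 1
    becomes \<open>1 / expectation Z\<close>.\<close>
  define W where "W \<omega> = Z \<omega> / expectation Z" for \<omega>
  have W[measurable]: "W \<in> borel_measurable M" unfolding W_def by measurable
  have W_bounds: "\<And>\<omega>. 0 \<le> W \<omega>" "\<And>\<omega>. W \<omega> \<le> 1 / expectation Z"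
    using bounds EZ by (auto simp: W_def divide_right_mono)
  have "martingale_measure M ?I (density M W)"
  proof (rule density_martingale_measure[OF W W_bounds _ _ I])
    show "AE \<omega> in M. 0 < W \<omega>" using pos by eventually_elim (use EZ in \<open>simp add: W_def\<close>)
    show "expectation W = 1" using EZ by (simp add: W_def[abs_def])
    show "(\<integral>\<omega>. W \<omega> * X \<omega> \<partial>M) \<le> 0" if "X \<in> ?I" for X
      using le[OF that] EZ by (simp add: W_def divide_nonpos_pos)
  qed
  moreover have "has_bounded_density M (density M W)"
    unfolding has_bounded_density_def
    using W_bounds by (intro bexI[OF _ W] exI[of _ "1 / expectation Z"]) auto
  ultimately show "\<exists>Q. martingale_measure M ?I Q \<and> has_bounded_density M Q" by blast
next
  assume "\<exists>Q. martingale_measure M (net_trades M T F S) Q \<and> has_bounded_density M Q"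
  then show "viable M (net_trades M T F S)"
    using martingale_measure_imp_viable by blast
qed

end
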